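(* Let $K$ be a class of structures for a finite relational language $L$. The following are equivalent: (1) $K\le_c FLO$. (2) There is a c.e. set $\mathcal{S}$ of pairs $(\mathcal{A},\mathcal{B})$, with $\mathcal{A}$ a finite $L$-structure and $\mathcal{B}$ a finite linear ordering, such that (a) for every $\mathcal{C}\in K$ there is $(\mathcal{A},\mathcal{B})\in\mathcal{S}$ with $\mathcal{A}\subseteq\mathcal{C}$ which is sufficient for $\mathcal{C}$, meaning that for every $(\mathcal{A}',\mathcal{B}')\in\mathcal{S}$ with $\mathcal{A}'\subseteq\mathcal{C}$ we have $\mathcal{B}'\subseteq\mathcal{B}$; and (b) for $\mathcal{C},\mathcal{C}'\in K$, if $(\mathcal{A},\mathcal{B}),(\mathcal{A}',\mathcal{B}')\in\mathcal{S}$ are sufficient for $\mathcal{C},\mathcal{C}'$ respectively (and satisfy $\mathcal{A}\subseteq\mathcal{C}$, $\mathcal{A}'\subseteq\mathcal{C}'$), then $\mathcal{C}\cong\mathcal{C}'$ iff $\mathcal{B}\cong\mathcal{B}'$. (3) There is a computable sequence $(\varphi_n)_{n\in\omega}$ of computable $\Sigma_1$ $L$-sentences such that (a) for every $\mathcal{A}\in K$ there is $n$ with $\mathcal{A}\models\varphi_n\wedge\neg\varphi_{n+1}$; (b) for every $\mathcal{A}\in K$ and every $n$, $\mathcal{A}\models\varphi_{n+1}\rightarrow\varphi_n$; (c) for all $\mathcal{A},\mathcal{A}'\in K$ with $\mathcal{A}\not\cong\mathcal{A}'$, there is $n$ such that $\varphi_n$ is true in exactly one of $\mathcal{A},\m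athcal{A}'$.
   Context: Conventions: every structure is for a finite relational language with universe a subset of $\omega$; a class is a collection of structures for one language closed under isomorphism. $\subseteq$ between structures denotes the substructure relation. $D(\mathcal{A})$ is the atomic diagram of $\mathcal{A}$. A computable transformation from $K$ to $K'$ is a c.e. set $\Phi$ of pairs $(\alpha,\varphi)$, $\alpha$ a finite subset of the atomic diagram of a finite structure in the language of $K$, $\varphi$ an atomic sentence or negation of one in the language of $K'$, such that for every $\mathcal{A}\in K$, $\{\varphi:(\exists\alpha\subseteq D(\mathcal{A}))(\alpha,\varphi)\in\Phi\}=D(\mathcal{B})$ for some $\mathcal{B}\in K'$. A computable embedding is a computable transformation with $\mathcal{A}\cong\mathcal{A}'\iff\Phi(\mathcal{A})\cong\Phi(\mathcal{A}')$; $K\le_c K'$ means one exists. $FLO$ is the class of finite linear orders. A computable $\Sigma_1$ sentence is a c.e. (possibly infinite) disjunction of finitary existential sentences; a computable sequence of them is given by a computable sequence of c.e. indices. *)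

theory Defs
  imports Main "HOL-Library.Nat_Bijection"
begin

datatype recf = RZero | RSucc | RProj nat | RComp recf "recf list"
  | RPrec recf recf | RMu recf

inductive reval :: "recf \<Rightarrow> nat list \<Rightarrow> nat \<Rightarrow> bool" where
  zero: "reval RZero xs 0"
| succ: "reval RSucc (x # xs) (Suc x)"
| proj: "i < length xs \<Longrightarrow> reval (RProj i) xs (xs ! i)"
| comp: "length ys = length gs \<Longrightarrow> (\<forall>i < length gs. reval (gs ! i) xs (ys ! i))
         \<Longrightarrow> reval f ys z \<Longrightarrow> reval (RComp f gs) xs z"
| prec0: "reval f xs y \<Longrightarrow> reval (RPrec f g) (0 # xs) y"
| precS: "reval (RPrec f g) (n # xs) y \<Longrightarrow> reval g (n # y # xs) z
          \<Longrightarrow> reval (RPrec f g) (Suc n # xs) z"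
| mu: "reval f (n # xs) 0 \<Longrightarrow> (\<forall>m < n. \<exists>y. reval f (m # xs) y \<and> y > 0)
       \<Longrightarrow> reval (RMu f) xs n"

definition ce_set :: "nat set \<Rightarrow> bool" where
  "ce_set A \<longleftrightarrow> (\<exists>f. \<forall>x. x \<in> A \<longleftrightarrow> (\<exists>y. reval f [x] y))"

text \<open>A signature is the list of arities of the relation symbols 0,...,length sig - 1.
  A structure is a universe (a subset of omega) together with an interpretation of the
  relation symbols; relations only hold on tuples of the right arity from the universe.
  Structures have nonempty universes.\<close>

type_synonym struct = "nat set \<times> (nat \<Rightarrow> nat list \<Rightarrow> bool)"

definition is_struct :: "nat list \<Rightarrow> struct \<Rightarrow> bool" where
  "is_struct sig M \<longleftrightarrow> fst M \<noteq> {} \<and>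
     (\<forall>i as. snd M i as \<longrightarrow> i < length sig \<and> length as = sig ! i \<and> set as \<subseteq> fst M)"

definition substructure :: "struct \<Rightarrow> struct \<Rightarrow> bool" where
  "substructure A C \<longleftrightarrow> fst A \<subseteq> fst C \<and>
     (\<forall>i as. set as \<subseteq> fst A \<longrightarrow> (snd A i as \<longleftrightarrow> snd C i as))"

definition iso :: "struct \<Rightarrow> struct \<Rightarrow> bool" where
  "iso A B \<longleftrightarrow> (\<exists>f. bij_betw f (fst A) (fst B) \<and>
     (\<forall>i as. set as \<subseteq> fst A \<longrightarrow> (snd A i as \<longleftrightarrow> snd B i (map f as))))"

definition is_class :: "nat list \<Rightarrow> struct set \<Rightarrow> bool" where
  "is_class sig K \<longleftrightarrow> (\<forall>M \<in> K. is_struct sig M) \<and>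
     (\<forall>M N. M \<in> K \<longrightarrow> is_struct sig N \<longrightarrow> iso M N \<longrightarrow> N \<in> K)"

text \<open>Linear orders: language with one binary relation symbol (symbol 0), read as \<le>.\<close>
definition LO_sig :: "nat list" where "LO_sig = [2]"

definition FLO :: "struct set" where
  "FLO = {M. is_struct LO_sig M \<and> finite (fst M) \<and>
     (\<forall>a \<in> fst M. snd M 0 [a, a]) \<and>
     (\<forall>a \<in> fst M. \<forall>b \<in> fst M. snd M 0 [a, b] \<and> snd M 0 [b, a] \<longrightarrow> a = b) \<and>
     (\<forall>a \<in> fst M. \<forall>b \<in> fst M. \<forall>c \<in> fst M. snd M 0 [a, b] \<and> snd M 0 [b, c] \<longrightarrow> snd M 0 [a, c]) \<and>
     (\<forall>a \<in> fst M. \<forall>b \<in> fst M. snd M 0 [a, b] \<or> snd M 0 [b, a])}"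

datatype atom = AEq nat nat | ARel nat "nat list"

type_synonym literal = "bool \<times> atom"  \<comment> \<open>True: the atom; False: its negation\<close>

definition diag :: "nat list \<Rightarrow> struct \<Rightarrow> literal set" where
  "diag sig M =
     {(True, AEq a a) | a. a \<in> fst M}
   \<union> {(False, AEq a b) | a b. a \<in> fst M \<and> b \<in> fst M \<and> a \<noteq> b}
   \<union> {(True, ARel i as) | i as. snd M i as}
   \<union> {(False, ARel i as) | i as. i < length sig \<and> length as = sig ! i \<and>
                                 set as \<subseteq> fst M \<and> \<not> snd M i as}"

fun enc_atom :: "atom \<Rightarrow> nat" where
  "enc_atom (AEq a b) = prod_encode (0, prod_encode (a, b))"
| "enc_atom (ARel i as) = prod_encode (1, prod_encode (i, list_encode as))"

fun enc_lit :: "literal \<Rightarrow> nat" where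
  "enc_lit (b, at) = prod_encode (if b then 1 else 0, enc_atom at)"

definition enc_lits :: "literal list \<Rightarrow> nat" where
  "enc_lits xs = list_encode (map enc_lit xs)"

text \<open>A transformation is a set of pairs (alpha, phi); the finite set alpha is given by a list.\<close>
type_synonym transf = "(literal list \<times> literal) set"

definition apply_transf :: "transf \<Rightarrow> nat list \<Rightarrow> struct \<Rightarrow> literal set" where
  "apply_transf \<Phi> sig A = {\<phi>. \<exists>\<alpha>. (\<alpha>, \<phi>) \<in> \<Phi> \<and> set \<alpha> \<subseteq> diag sig A}"

definition computable_transformation ::
  "nat list \<Rightarrow> struct set \<Rightarrow> nat list \<Rightarrow> struct set \<Rightarrow> transf \<Rightarrow> bool" where
  "computable_transformation sig K sig' K' \<Phi> \<longleftrightarrow>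
     ce_set {prod_encode (enc_lits \<alpha>, enc_lit \<phi>) | \<alpha> \<phi>. (\<alpha>, \<phi>) \<in> \<Phi>} \<and>
     (\<forall>(\<alpha>, \<phi>) \<in> \<Phi>. \<exists>M. is_struct sig M \<and> finite (fst M) \<and> set \<alpha> \<subseteq> diag sig M) \<and>
     (\<forall>A \<in> K. \<exists>B \<in> K'. apply_transf \<Phi> sig A = diag sig' B)"

definition computable_embedding ::
  "nat list \<Rightarrow> struct set \<Rightarrow> nat list \<Rightarrow> struct set \<Rightarrow> transf \<Rightarrow> bool" where
  "computable_embedding sig K sig' K' \<Phi> \<longleftrightarrow>
     computable_transformation sig K sig' K' \<Phi> \<and>
     (\<forall>A A' B B'. A \<in> K \<longrightarrow> A' \<in> K \<longrightarrow> B \<in> K' \<longrightarrow> B' \<in> K' \<longrightarrow>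
        apply_transf \<Phi> sig A = diag sig' B \<longrightarrow> apply_transf \<Phi> sig A' = diag sig' B' \<longrightarrow>
        (iso A A' \<longleftrightarrow> iso B B'))"

definition comp_reducible :: "nat list \<Rightarrow> struct set \<Rightarrow> nat list \<Rightarrow> struct set \<Rightarrow> bool" where
  "comp_reducible sig K sig' K' \<longleftrightarrow> (\<exists>\<Phi>. computable_embedding sig K sig' K' \<Phi>)"

definition ce_struct_pairs :: "nat list \<Rightarrow> nat list \<Rightarrow> (struct \<times> struct) set \<Rightarrow> bool" where
  "ce_struct_pairs sig sig' S \<longleftrightarrow>
     ce_set {prod_encode (enc_lits xs, enc_lits ys) | xs ys A B.
               (A, B) \<in> S \<and> set xs = diag sig A \<and> set ys = diag sig' B}"

definition sufficient :: "(struct \<times> struct) set \<Rightarrow> struct \<Rightarrow> struct \<times> struct \<Rightarrow> bool" where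
  "sufficient S C AB \<longleftrightarrow>
     (\<forall>A' B'. (A', B') \<in> S \<longrightarrow> substructure A' C \<longrightarrow> substructure B' (snd AB))"

datatype fm = FEq nat nat | FRel nat "nat list" | FNot fm | FAnd fm fm | FOr fm fm

fun wf_fm :: "nat list \<Rightarrow> nat \<Rightarrow> fm \<Rightarrow> bool" where
  "wf_fm sig k (FEq i j) \<longleftrightarrow> i < k \<and> j < k"
| "wf_fm sig k (FRel r vs) \<longleftrightarrow> r < length sig \<and> length vs = sig ! r \<and> (\<forall>v \<in> set vs. v < k)"
| "wf_fm sig k (FNot p) \<longleftrightarrow> wf_fm sig k p"
| "wf_fm sig k (FAnd p q) \<longleftrightarrow> wf_fm sig k p \<and> wf_fm sig k q"
| "wf_fm sig k (FOr p q) \<longleftrightarrow> wf_fm sig k p \<and> wf_fm sig k q"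

fun eval_fm :: "(nat \<Rightarrow> nat list \<Rightarrow> bool) \<Rightarrow> nat list \<Rightarrow> fm \<Rightarrow> bool" where
  "eval_fm I as (FEq i j) \<longleftrightarrow> as ! i = as ! j"
| "eval_fm I as (FRel r vs) \<longleftrightarrow> I r (map (\<lambda>v. as ! v) vs)"
| "eval_fm I as (FNot p) \<longleftrightarrow> \<not> eval_fm I as p"
| "eval_fm I as (FAnd p q) \<longleftrightarrow> eval_fm I as p \<and> eval_fm I as q"
| "eval_fm I as (FOr p q) \<longleftrightarrow> eval_fm I as p \<or> eval_fm I as q"

text \<open>A finitary existential sentence (k, psi) stands for \<exists>x_0...x_(k-1). psi.\<close>
type_synonym ex_sentence = "nat \<times> fm"

definition wf_ex :: "nat list \<Rightarrow> ex_sentence \<Rightarrow> bool" where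
  "wf_ex sig s \<longleftrightarrow> wf_fm sig (fst s) (snd s)"

definition sat_ex :: "struct \<Rightarrow> ex_sentence \<Rightarrow> bool" where
  "sat_ex M s \<longleftrightarrow> (\<exists>as. length as = fst s \<and> set as \<subseteq> fst M \<and> eval_fm (snd M) as (snd s))"

text \<open>A computable Sigma_1 sentence is the disjunction of a c.e. set of finitary existential sentences.\<close>
definition sat_sigma1 :: "struct \<Rightarrow> ex_sentence set \<Rightarrow> bool" where
  "sat_sigma1 M W \<longleftrightarrow> (\<exists>s \<in> W. sat_ex M s)"

fun enc_fm :: "fm \<Rightarrow> nat" where
  "enc_fm (FEq i j) = prod_encode (0, prod_encode (i, j))"
| "enc_fm (FRel r vs) = prod_encode (1, prod_encode (r, list_encode vs))"
| "enc_fm (FNot p) = prod_encode (2, enc_fm p)"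
| "enc_fm (FAnd p q) = prod_encode (3, prod_encode (enc_fm p, enc_fm q))"
| "enc_fm (FOr p q) = prod_encode (4, prod_encode (enc_fm p, enc_fm q))"

definition enc_ex :: "ex_sentence \<Rightarrow> nat" where
  "enc_ex s = prod_encode (fst s, enc_fm (snd s))"

text \<open>A computable sequence of computable Sigma_1 L-sentences: the family of disjunct sets is
  uniformly c.e., i.e. the set of pairs (n, code of a disjunct of phi_n) is c.e.\<close>
definition computable_sigma1_seq :: "nat list \<Rightarrow> (nat \<Rightarrow> ex_sentence set) \<Rightarrow> bool" where
  "computable_sigma1_seq sig \<phi> \<longleftrightarrow>
     (\<forall>n. \<forall>s \<in> \<phi> n. wf_ex sig s) \<and>
     ce_set {prod_encode (n, enc_ex s) | n s. s \<in> \<phi> n}"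

end

theory Submission
  imports Defs
begin

text \<open>A transformation into finite linear orders produces, on \<open>C\<close>, a finite diagram, so finitely many
  facts about \<open>C\<close> already force the whole output; the pairs (finite substructure, finite order
  contained in its output) therefore include a sufficient one for every \<open>C\<close>. Conversely the union of
  the orders attached to the finite substructures of \<open>C\<close> is the sufficient one. For the sentences,
  only the number of elements of the output matters, since finite linear orders of equal size are
  isomorphic: \<open>\<phi>\<^sub>n\<close> says that some finite diagram realised in the structure forces more than \<open>n\<close>
  elements into the output. This is invariant because a realisation in \<open>A\<close> becomes an actual inclusion
  of diagrams in an isomorphic copy of \<open>A\<close>. Conversely \<open>A\<close> is sent to the order \<open>0 < ... < n\<close>, where
  \<open>\<phi>\<^sub>n\<close> is the last sentence true in \<open>A\<close>.

  Enumerability is handled through predicates of the form \<open>\<exists>y. g (y, x) = 0\<close> with \<open>g\<close> recursive, which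
  are closed under conjunction, disjunction, existential and bounded universal quantification, and
  which contain the graphs of all partial recursive functions.\<close>

subsection \<open>Recursive functions\<close>

text \<open>Two features of the definitions shape the proof. A transformation reads diagrams only
  positively: it is an enumeration operator, hence monotone, and each finite part of its output has
  a finite use. Diagrams contain negative literals, so monotonicity follows the substructure
  relation. On the other hand the output depends on the actual elements of a structure; an embedding
  controls only its isomorphism type, so the sentences can count output elements but not name them.
  On the effective side no universal machine or step counter is built. The graph of each recursive
  function gets its existential form by induction on the program, with intermediate values
  quantified as list codes. There is no rule for negation, so negated conditions must be made
  positive: relations on numbers come with rules for their complements, implications become
  disjunctions, and truth of formulas is certified together with falsity. Universes are nonempty, so
  the least linear order has one element; this is the origin of \<open>Suc n\<close> in the
  counting.\<close>

inductive_cases reval_elims: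
  "reval RZero xs y" "reval RSucc xs y" "reval (RProj i) xs y" "reval (RComp f gs) xs y"
  "reval (RPrec f g) [] y" "reval (RPrec f g) (0 # xs) y" "reval (RPrec f g) (Suc n # xs) y"
  "reval (RMu f) xs y"

lemma reval_det: "reval f xs y \<Longrightarrow> reval f xs z \<Longrightarrow> y = z"
proof (induction arbitrary: z rule: reval.induct)
  case (zero xs)
  then show ?case by (rule reval_elims) simp
next
  case (succ x xs)
  then show ?case by (rule reval_elims) simp
next
  case (proj i xs)
  from proj.prems show ?case by (rule reval_elims) simp
next
  case (comp ys gs xs f w)
  from comp.prems show ?case
  proof (rule reval_elims)
    fix zs
    assume zs: "length zs = length gs" "\<forall>i<length gs. reval (gs ! i) xs (zs ! i)" "reval f zs z"
    have "ys = zs"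
      using comp.IH(1) comp.hyps zs by (intro nth_equalityI) auto
    then show "w = z" using comp.IH(2) zs by blast
  qed
next
  case (prec0 f xs y g)
  from prec0.prems show ?case by (rule reval_elims) (rule prec0.IH)
next
  case (precS f g n xs y w)
  from precS.prems show ?case
  proof (rule reval_elims)
    fix y' assume y': "reval (RPrec f g) (n # xs) y'" "reval g (n # y' # xs) z"
    show "w = z" using precS.IH(1)[OF y'(1)] precS.IH(2) y'(2) by simp
  qed
next
  case (mu f n xs)
  from mu.prems have z: "reval f (z # xs) 0" "\<forall>m<z. \<exists>y. reval f (m # xs) y \<and> y > 0"
    by (rule reval_elims, simp)+
  \<comment> \<open>Whichever candidate is smaller is a zero of \<open>f\<close> at an argument
    where the other derivation requires a positive value.\<close>
  show ?case
  proof (rule linorder_cases[of n z])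
    assume "n < z"
    then obtain y where "reval f (n # xs) y" "y > 0" using z(2) by blast
    then show ?thesis using mu.IH(1) by fastforce
  next
    assume "z < n"
    then show ?thesis using z(1) mu.IH(2) by fastforce
  qed
qed

lemma reval_comp1: "reval g xs a \<Longrightarrow> reval f [a] z \<Longrightarrow> reval (RComp f [g]) xs z"
  by (rule reval.comp[where ys = "[a]"]) auto

lemma reval_comp2:
  "reval g xs a \<Longrightarrow> reval h xs b \<Longrightarrow> reval f [a, b] z \<Longrightarrow> reval (RComp f [g, h]) xs z"
  by (rule reval.comp[where ys = "[a, b]"]) (auto simp: less_Suc_eq)

lemma reval_proj: "i < length xs \<Longrightarrow> y = xs ! i \<Longrightarrow> reval (RProj i) xs y"
  by (simp add: reval.proj)

lemma reval_succ_proj: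
  "i < length xs \<Longrightarrow> y = Suc (xs ! i) \<Longrightarrow> reval (RComp RSucc [RProj i]) xs y"
  by (simp add: reval_comp1[OF reval.proj] reval.succ)

section \<open>Primitive recursive arithmetic and the inverses of the Cantor pairing\<close>

definition R_add :: recf where "R_add = RPrec (RProj 0) (RComp RSucc [RProj 1])"

lemma reval_add: "reval R_add [n, x] (n + x)"
  unfolding R_add_def
  by (induction n) (auto intro!: reval.prec0 reval.precS reval_comp1 reval_proj reval.succ)

definition R_pred :: recf where "R_pred = RPrec RZero (RProj 0)"

lemma reval_pred: "reval R_pred [n] (n - 1)"
proof (induction n)
  case 0
  show ?case unfolding R_pred_def by (auto intro!: reval.prec0 reval.zero)
next
  case (Suc n)
  have "reval (RProj 0) [n, n - 1] (Suc n - 1)" by (simp add: reval_proj)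
  then show ?case using Suc unfolding R_pred_def by (rule reval.precS[rotated])
qed

text \<open>\<open>RPrec\<close> recurses on the head of the list, so the subtrahend comes first;
  \<open>recursive_diff\<close> restores the usual order.\<close>

definition R_sub :: recf where "R_sub = RPrec (RProj 0) (RComp R_pred [RProj 1])"

lemma reval_sub: "reval R_sub [n, x] (x - n)"
proof (induction n)
  case 0
  show ?case unfolding R_sub_def by (auto intro!: reval.prec0 reval_proj)
next
  case (Suc n)
  have "reval (RComp R_pred [RProj 1]) [n, x - n, x] (x - Suc n)"
    using reval_pred[of "x - n"] by (intro reval_comp1[where a = "x - n"] reval_proj) auto
  then show ?case using Suc unfolding R_sub_def by (rule reval.precS[rotated])
qed

definition R_tri :: recf where
  "R_tri = RPrec RZero (RComp R_add [RProj 1, RComp RSucc [RProj 0]])"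

lemma reval_tri: "reval R_tri [n] (triangle n)"
proof (induction n)
  case 0
  show ?case unfolding R_tri_def by (auto intro!: reval.prec0 reval.zero)
next
  case (Suc n)
  have "reval (RComp R_add [RProj 1, RComp RSucc [RProj 0]]) [n, triangle n] (triangle (Suc n))"
    using reval_add[of "triangle n" "Suc n"]
    by (intro reval_comp2[where a = "triangle n" and b = "Suc n"] reval_proj reval_succ_proj) auto
  then show ?case using Suc unfolding R_tri_def by (rule reval.precS[rotated])
qed

definition R_pair :: recf where
  "R_pair = RComp R_add [RComp R_tri [R_add], RProj 0]"

lemma reval_pair: "reval R_pair [m, n] (prod_encode (m, n))"
  unfolding R_pair_def prod_encode_def
  by (auto intro!: reval_comp2 reval_comp1 reval_add reval_tri reval_proj)

definition pfst :: "nat \<Rightarrow> nat" where "pfst z = fst (prod_decode z)"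
definition psnd :: "nat \<Rightarrow> nat" where "psnd z = snd (prod_decode z)"

lemma pfst_encode [simp]: "pfst (prod_encode (a, b)) = a"
  and psnd_encode [simp]: "psnd (prod_encode (a, b)) = b"
  by (simp_all add: pfst_def psnd_def)

lemma encode_pfst_psnd [simp]: "prod_encode (pfst z, psnd z) = z"
  by (simp add: pfst_def psnd_def)

lemma psnd_0 [simp]: "psnd 0 = 0"
  using psnd_encode[of 0 0] by (simp add: prod_encode_def)

text \<open>The code of the pair \<open>(a, b)\<close> lies in the interval from \<open>triangle (a + b)\<close> to
  \<open>triangle (a + b + 1)\<close>, so minimisation recovers \<open>a + b\<close>.\<close>

definition R_root :: recf where
  "R_root = RMu (RComp R_sub [RComp R_tri [RComp RSucc [RProj 0]], RComp RSucc [RProj 1]])"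

lemma triangle_mono: "m \<le> n \<Longrightarrow> triangle m \<le> triangle n"
  by (induction rule: dec_induct) auto

lemma reval_root: "reval R_root [prod_encode (a, b)] (a + b)"
proof -
  let ?z = "prod_encode (a, b)"
  let ?f = "RComp R_sub [RComp R_tri [RComp RSucc [RProj 0]], RComp RSucc [RProj 1]]"
  have f: "reval ?f [s, ?z] (Suc ?z - triangle (Suc s))" for s
    by (rule reval_comp2[where a = "triangle (Suc s)" and b = "Suc ?z"])
       (auto intro!: reval_comp1[where a = "Suc s"] reval_succ_proj reval_tri reval_sub
         simp del: triangle_Suc)
  have "reval ?f [a + b, ?z] 0"
    using f[of "a + b"] by (simp add: prod_encode_def)
  moreover have "Suc ?z - triangle (Suc m) > 0" if "m < a + b" for m
    using triangle_mono[of "Suc m" "a + b"] that by (simp add: prod_encode_def)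
  ultimately show ?thesis
    unfolding R_root_def using f by (blast intro: reval.mu)
qed

text \<open>The code of a pair is \<open>triangle (a + b) + a\<close>: removing the triangle number
  leaves \<open>a\<close>, and removing \<open>a\<close> from the root \<open>a + b\<close> leaves
  \<open>b\<close>.\<close>

definition R_fst :: recf where "R_fst = RComp R_sub [RComp R_tri [R_root], RProj 0]"
definition R_snd :: recf where "R_snd = RComp R_sub [R_fst, R_root]"

lemma reval_fst: "reval R_fst [z] (pfst z)"
proof -
  have "reval R_fst [prod_encode (a, b)] a" for a b
    using reval_sub[of "triangle (a + b)" "prod_encode (a, b)"] unfolding R_fst_def
    by (intro reval_comp2[where a = "triangle (a + b)" and b = "prod_encode (a, b)"]
        reval_comp1[OF reval_root] reval_tri reval_proj) (auto simp: prod_encode_def)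
  from this[of "pfst z" "psnd z"] show ?thesis by simp
qed

lemma reval_snd: "reval R_snd [z] (psnd z)"
proof -
  have "reval R_snd [prod_encode (a, b)] b" for a b
    using reval_fst[of "prod_encode (a, b)"] reval_sub[of a "a + b"] unfolding R_snd_def
    by (intro reval_comp2[OF _ reval_root]) auto
  from this[of "pfst z" "psnd z"] show ?thesis by simp
qed

text \<open>Only unary functions are considered; several arguments are packed with \<^const>\<open>prod_encode\<close>,
  so that all closure properties are syntax-directed rules with a single environment variable.\<close>

definition recursive :: "(nat \<Rightarrow> nat) \<Rightarrow> bool" where
  "recursive F \<longleftrightarrow> (\<exists>f. \<forall>x. reval f [x] (F x))"

named_theorems rec_intros

lemma recursive_id [rec_intros]: "recursive (\<lambda>x. x)"
  unfolding recursive_def by (auto intro!: exI[of _ "RProj 0"] reval_proj)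

lemma recursive_comp: "recursive G \<Longrightarrow> recursive F \<Longrightarrow> recursive (\<lambda>x. G (F x))"
  unfolding recursive_def by (meson reval_comp1)

lemma recursive_comp2:
  assumes "\<And>x y. reval h [x, y] (H x y)" "recursive F" "recursive G"
  shows "recursive (\<lambda>x. H (F x) (G x))"
  using assms unfolding recursive_def by (meson reval_comp2)

lemma recursive_Suc [rec_intros]: "recursive F \<Longrightarrow> recursive (\<lambda>x. Suc (F x))"
  by (rule recursive_comp) (auto simp: recursive_def intro: reval.succ)

lemma recursive_const [rec_intros]: "recursive (\<lambda>x. c)"
proof (induction c)
  case 0
  show ?case by (auto simp: recursive_def intro: reval.zero)
qed (rule recursive_Suc)

lemma recursive_pfst [rec_intros]: "recursive F \<Longrightarrow> recursive (\<lambda>x. pfst (F x))"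
  by (rule recursive_comp) (auto simp: recursive_def intro: reval_fst)

lemma recursive_psnd [rec_intros]: "recursive F \<Longrightarrow> recursive (\<lambda>x. psnd (F x))"
  by (rule recursive_comp) (auto simp: recursive_def intro: reval_snd)

lemma recursive_pair [rec_intros]:
  "recursive F \<Longrightarrow> recursive G \<Longrightarrow> recursive (\<lambda>x. prod_encode (F x, G x))"
  by (rule recursive_comp2[OF reval_pair])

lemma recursive_add [rec_intros]:
  "recursive F \<Longrightarrow> recursive G \<Longrightarrow> recursive (\<lambda>x. F x + G x)"
  by (rule recursive_comp2[OF reval_add])

lemma recursive_diff [rec_intros]:
  "recursive F \<Longrightarrow> recursive G \<Longrightarrow> recursive (\<lambda>x. F x - G x)"
  by (rule recursive_comp2[OF reval_sub, of G F])

lemma recursive_rec_nat: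
  assumes "recursive F" "recursive N"
    and "recursive (\<lambda>z. H (pfst z) (pfst (psnd z)) (psnd (psnd z)))"
  shows "recursive (\<lambda>x. rec_nat (F x) (H x) (N x))"
proof -
  obtain f g h where f: "\<And>x. reval f [x] (F x)" and g: "\<And>x. reval g [x] (N x)"
    and h: "\<And>z. reval h [z] (H (pfst z) (pfst (psnd z)) (psnd (psnd z)))"
    using assms unfolding recursive_def by metis
  \<comment> \<open>The step of \<open>RPrec\<close> receives counter, previous value and parameter
    in this order, whereas \<open>h\<close> expects one code with the parameter outermost; hence the
    projections 2, 0, 1.\<close>
  define s where "s = RComp h [RComp R_pair [RProj 2, RComp R_pair [RProj 0, RProj 1]]]"
  have s: "reval s [n, r, x] (H x n r)" for n r x
  proof -
    have "reval (RComp R_pair [RProj 0, RProj 1]) [n, r, x] (prod_encode (n, r))"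
      by (rule reval_comp2[OF reval_proj reval_proj reval_pair]) auto
    then have "reval (RComp R_pair [RProj 2, RComp R_pair [RProj 0, RProj 1]]) [n, r, x]
        (prod_encode (x, prod_encode (n, r)))"
      by (rule reval_comp2[OF reval_proj _ reval_pair, rotated 2]) auto
    then show ?thesis
      unfolding s_def using h[of "prod_encode (x, prod_encode (n, r))"]
      by (simp add: reval_comp1)
  qed
  have "reval (RPrec f s) [n, x] (rec_nat (F x) (H x) n)" for n x
    by (induction n) (auto intro: reval.prec0 reval.precS f s)
  then have "reval (RComp (RPrec f s) [g, RProj 0]) [x] (rec_nat (F x) (H x) (N x))" for x
    using g by (auto intro!: reval_comp2[where b = x] reval_proj)
  then show ?thesis unfolding recursive_def by blast
qed

text \<open>Case distinction is primitive recursion whose step forgets the counter and the previous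
  value.\<close>

lemma recursive_if [rec_intros]:
  assumes "recursive C" "recursive F" "recursive G"
  shows "recursive (\<lambda>x. if C x = 0 then F x else G x)"
proof -
  have "recursive (\<lambda>x. rec_nat (F x) (\<lambda>_ _. G x) (C x))"
    by (intro recursive_rec_nat assms recursive_comp[OF assms(3)] rec_intros)
  moreover have "rec_nat (F x) (\<lambda>_ _. G x) (C x) = (if C x = 0 then F x else G x)" for x
    by (cases "C x") auto
  ultimately show ?thesis by simp
qed

lemma recursive_funpow:
  assumes "recursive G" "recursive F" "recursive N"
  shows "recursive (\<lambda>x. (G ^^ N x) (F x))"
proof -
  have "recursive (\<lambda>x. rec_nat (F x) (\<lambda>_ r. G r) (N x))"
    by (intro recursive_rec_nat assms recursive_comp[OF assms(1)] rec_intros)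
  moreover have "rec_nat a (\<lambda>_ r. G r) n = (G ^^ n) a" for a n
    by (induction n) auto
  ultimately show ?thesis by simp
qed

lemma recursive_sum:
  assumes "recursive N" "recursive (\<lambda>z. G (pfst z) (psnd z))"
  shows "recursive (\<lambda>x. \<Sum>i<N x. G x i)"
proof -
  have "recursive (\<lambda>x. rec_nat 0 (\<lambda>i r. r + G x i) (N x))"
    using recursive_comp[OF assms(2), of "\<lambda>z. prod_encode (pfst z, pfst (psnd z))"]
    by (intro recursive_rec_nat assms rec_intros) (simp add: rec_intros)
  moreover have "rec_nat 0 (\<lambda>i r. r + G x i) n = (\<Sum>i<n. G x i)" for x n
    by (induction n) auto
  ultimately show ?thesis by simp
qed

subsection \<open>Lists coded by numbers\<close>

text \<open>The code of a nonempty list is the successor of a pair code, hence the predecessor. The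
  code 0 of the empty list is a fixed point, because the pair code 0 has second component 0;
  iterating past the end is therefore harmless.\<close>

definition ctl :: "nat \<Rightarrow> nat" where "ctl c = psnd (c - 1)"
definition cdrop :: "nat \<Rightarrow> nat \<Rightarrow> nat" where "cdrop n c = (ctl ^^ n) c"
definition cnth :: "nat \<Rightarrow> nat \<Rightarrow> nat" where "cnth c n = pfst (cdrop n c - 1)"

lemma recursive_ctl [rec_intros]: "recursive F \<Longrightarrow> recursive (\<lambda>x. ctl (F x))"
  unfolding ctl_def by (intro rec_intros)

lemma recursive_cdrop [rec_intros]:
  "recursive N \<Longrightarrow> recursive F \<Longrightarrow> recursive (\<lambda>x. cdrop (N x) (F x))"
  unfolding cdrop_def by (intro recursive_funpow rec_intros)

lemma recursive_cnth [rec_intros]: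
  "recursive F \<Longrightarrow> recursive N \<Longrightarrow> recursive (\<lambda>x. cnth (F x) (N x))"
  unfolding cnth_def by (intro rec_intros)

lemma ctl_encode [simp]: "ctl (list_encode xs) = list_encode (tl xs)"
  by (cases xs) (auto simp: ctl_def)

lemma cdrop_encode [simp]: "cdrop n (list_encode xs) = list_encode (drop n xs)"
proof -
  have "(ctl ^^ n) (list_encode xs) = list_encode (drop n xs)"
    by (induction n) (auto simp: drop_Suc tl_drop)
  then show ?thesis by (simp add: cdrop_def)
qed

lemma list_encode_eq_0 [simp]: "list_encode xs = 0 \<longleftrightarrow> xs = []"
  by (cases xs) auto

lemma cnth_encode [simp]: "n < length xs \<Longrightarrow> cnth (list_encode xs) n = xs ! n"
  by (simp add: cnth_def Cons_nth_drop_Suc[symmetric])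

lemma cdrop_eq_0 [simp]: "cdrop n c = 0 \<longleftrightarrow> length (list_decode c) \<le> n"
  using cdrop_encode[of n "list_decode c"] by simp

lemma cnth_decode: "n < length (list_decode c) \<Longrightarrow> cnth c n = list_decode c ! n"
  using cnth_encode[of n "list_decode c"] by simp

lemma length_le_list_encode: "length xs \<le> list_encode xs"
proof (induction xs)
  case (Cons a xs)
  then show ?case using le_prod_encode_2[of "list_encode xs" a] by simp
qed simp

subsection \<open>Semidecidable predicates\<close>

definition semidec :: "(nat \<Rightarrow> bool) \<Rightarrow> bool" where
  "semidec P \<longleftrightarrow> (\<exists>g. recursive g \<and> (\<forall>x. P x \<longleftrightarrow> (\<exists>y. g (prod_encode (y, x)) = 0)))"

named_theorems semi_intros

lemma semidecI:
  assumes "recursive (\<lambda>z. g (pfst z) (psnd z))" "\<And>x. P x \<longleftrightarrow> (\<exists>y. g y x = 0)"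
  shows "semidec P"
  unfolding semidec_def using assms by (intro exI[of _ "\<lambda>z. g (pfst z) (psnd z)"]) simp

text \<open>The recursive matrix is handed out as a binary function with its own closure rule, so
  that terms built from it are handled by \<open>intro\<close> like those built from the basic
  functions.\<close>

lemma semidecE:
  assumes "semidec P"
  obtains g where "\<And>Y X. recursive Y \<Longrightarrow> recursive X \<Longrightarrow> recursive (\<lambda>z. g (Y z) (X z))"
    "\<And>x. P x \<longleftrightarrow> (\<exists>y. g y x = 0)"
proof -
  obtain g where g: "recursive g" "\<And>x. P x \<longleftrightarrow> (\<exists>y. g (prod_encode (y, x)) = 0)"
    using assms unfolding semidec_def by blast
  show ?thesis
    by (rule that[of "\<lambda>y x. g (prod_encode (y, x))"])
       (use g in \<open>auto intro!: recursive_comp[OF g(1)] rec_intros\<close>)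
qed

lemma semidec_comp:
  assumes "semidec P" "recursive F"
  shows "semidec (\<lambda>x. P (F x))"
proof -
  obtain g where g: "\<And>Y X. recursive Y \<Longrightarrow> recursive X \<Longrightarrow> recursive (\<lambda>z. g (Y z) (X z))"
    "\<And>x. P x \<longleftrightarrow> (\<exists>y. g y x = 0)" using semidecE[OF assms(1)] by blast
  show ?thesis
    by (rule semidecI[where g = "\<lambda>y x. g y (F x)"])
       (auto simp: g(2) intro!: g(1) recursive_comp[OF assms(2)] rec_intros)
qed

lemma semidec_comp2:
  assumes "semidec (\<lambda>z. P (pfst z) (psnd z))" "recursive F" "recursive G"
  shows "semidec (\<lambda>x. P (F x) (G x))"
  using semidec_comp[OF assms(1), of "\<lambda>x. prod_encode (F x, G x)"] assms
  by (simp add: rec_intros)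

lemma semidec_comp3:
  assumes "semidec (\<lambda>z. P (pfst z) (pfst (psnd z)) (psnd (psnd z)))"
    "recursive F" "recursive G" "recursive H"
  shows "semidec (\<lambda>x. P (F x) (G x) (H x))"
  using semidec_comp[OF assms(1), of "\<lambda>x. prod_encode (F x, prod_encode (G x, H x))"] assms
  by (simp add: rec_intros)

lemma semidec_zero: "recursive F \<Longrightarrow> semidec (\<lambda>x. F x = 0)"
  by (rule semidecI[where g = "\<lambda>y x. F x"])
     (auto intro!: recursive_comp[where G = F] recursive_psnd recursive_id)

lemma semidec_eq [semi_intros]:
  assumes "recursive F" "recursive G" shows "semidec (\<lambda>x. F x = G x)"
proof -
  have "semidec (\<lambda>x. (F x - G x) + (G x - F x) = 0)"
    by (intro semidec_zero rec_intros assms)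
  moreover have "(F x - G x) + (G x - F x) = 0 \<longleftrightarrow> F x = G x" for x by auto
  ultimately show ?thesis by simp
qed

text \<open>Complements have no general rule, but equality is decidable: the test value is simply
  inverted.\<close>

lemma semidec_neq [semi_intros]:
  assumes "recursive F" "recursive G" shows "semidec (\<lambda>x. F x \<noteq> G x)"
proof -
  have "semidec (\<lambda>x. (if (F x - G x) + (G x - F x) = 0 then 1 else 0) = (0::nat))"
    by (intro semidec_zero rec_intros assms)
  moreover have "(if (F x - G x) + (G x - F x) = 0 then 1 else 0) = (0::nat) \<longleftrightarrow> F x \<noteq> G x" for x
    by auto
  ultimately show ?thesis by simp
qed

lemma semidec_less [semi_intros]:
  assumes "recursive F" "recursive G" shows "semidec (\<lambda>x. F x < G x)"
  using semidec_zero[of "\<lambda>x. Suc (F x) - G x"] assms by (simp add: rec_intros Suc_le_eq)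

lemma semidec_le [semi_intros]:
  assumes "recursive F" "recursive G" shows "semidec (\<lambda>x. F x \<le> G x)"
  using semidec_zero[of "\<lambda>x. F x - G x"] assms by (simp add: rec_intros)

lemma semidec_const [semi_intros]: "semidec (\<lambda>x. c)"
  using semidec_eq[OF recursive_const[of 0] recursive_const[of "if c then 0 else 1"]]
  by (cases c) auto

lemma semidec_conj [semi_intros]:
  assumes "semidec P" "semidec Q" shows "semidec (\<lambda>x. P x \<and> Q x)"
proof -
  obtain g where g: "\<And>Y X. recursive Y \<Longrightarrow> recursive X \<Longrightarrow> recursive (\<lambda>z. g (Y z) (X z))"
    "\<And>x. P x \<longleftrightarrow> (\<exists>y. g y x = 0)" using semidecE[OF assms(1)] by blast
  obtain h where h: "\<And>Y X. recursive Y \<Longrightarrow> recursive X \<Longrightarrow> recursive (\<lambda>z. h (Y z) (X z))"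
    "\<And>x. Q x \<longleftrightarrow> (\<exists>y. h y x = 0)" using semidecE[OF assms(2)] by blast
  show ?thesis
  proof (rule semidecI[where g = "\<lambda>y x. g (pfst y) x + h (psnd y) x"])
    show "(P x \<and> Q x) \<longleftrightarrow> (\<exists>y. g (pfst y) x + h (psnd y) x = 0)" for x
      unfolding g(2) h(2) by simp (metis pfst_encode psnd_encode)
  qed (intro g(1) h(1) rec_intros)
qed

text \<open>One witness serves both sides, since the existential quantifier distributes over
  disjunction; for conjunction the two witnesses had to be paired.\<close>

lemma semidec_disj [semi_intros]:
  assumes "semidec P" "semidec Q" shows "semidec (\<lambda>x. P x \<or> Q x)"
proof -
  obtain g where g: "\<And>Y X. recursive Y \<Longrightarrow> recursive X \<Longrightarrow> recursive (\<lambda>z. g (Y z) (X z))"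
    "\<And>x. P x \<longleftrightarrow> (\<exists>y. g y x = 0)" using semidecE[OF assms(1)] by blast
  obtain h where h: "\<And>Y X. recursive Y \<Longrightarrow> recursive X \<Longrightarrow> recursive (\<lambda>z. h (Y z) (X z))"
    "\<And>x. Q x \<longleftrightarrow> (\<exists>y. h y x = 0)" using semidecE[OF assms(2)] by blast
  show ?thesis
  proof (rule semidecI[where g = "\<lambda>y x. if g y x = 0 then 0 else h y x"])
    show "(P x \<or> Q x) \<longleftrightarrow> (\<exists>y. (if g y x = 0 then 0 else h y x) = 0)" for x
      unfolding g(2) h(2) ex_disj_distrib[symmetric] by (intro arg_cong[where f = Ex] ext) simp
  qed (intro g(1) h(1) rec_intros)
qed

lemma semidec_ex [semi_intros]:
  assumes "semidec (\<lambda>z. P (pfst z) (psnd z))" shows "semidec (\<lambda>x. \<exists>y. P x y)"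
proof -
  obtain g where g: "\<And>Y X. recursive Y \<Longrightarrow> recursive X \<Longrightarrow> recursive (\<lambda>z. g (Y z) (X z))"
    "\<And>x. P (pfst x) (psnd x) \<longleftrightarrow> (\<exists>y. g y x = 0)" using semidecE[OF assms(1)] by blast
  show ?thesis
  proof (rule semidecI[where g = "\<lambda>y x. g (psnd y) (prod_encode (x, pfst y))"])
    show "(\<exists>y. P x y) \<longleftrightarrow> (\<exists>y. g (psnd y) (prod_encode (x, pfst y)) = 0)" for x
      using g(2)[of "prod_encode (x, _)"] by simp (metis pfst_encode psnd_encode)
  qed (intro g(1) rec_intros)
qed

text \<open>The witnesses for the finitely many instances are collected in one list.\<close>

lemma semidec_all_less [semi_intros]:
  assumes "recursive N" "semidec (\<lambda>z. P (pfst z) (psnd z))"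
  shows "semidec (\<lambda>x. \<forall>i<N x. P x i)"
proof -
  obtain g where g: "\<And>Y X. recursive Y \<Longrightarrow> recursive X \<Longrightarrow> recursive (\<lambda>z. g (Y z) (X z))"
    "\<And>x. P (pfst x) (psnd x) \<longleftrightarrow> (\<exists>y. g y x = 0)" using semidecE[OF assms(2)] by blast
  show ?thesis
  proof (rule semidecI[where g = "\<lambda>y x. \<Sum>i<N x. g (cnth y i) (prod_encode (x, i))"])
    show "recursive (\<lambda>z. \<Sum>i<N (psnd z). g (cnth (pfst z) i) (prod_encode (psnd z, i)))"
      by (intro recursive_sum g(1) rec_intros recursive_comp[OF assms(1)])
    fix x
    have "(\<forall>i<N x. P x i) \<longleftrightarrow> (\<exists>y. \<forall>i<N x. g (cnth y i) (prod_encode (x, i)) = 0)"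
    proof
      assume "\<forall>i<N x. P x i"
      then obtain w where w: "\<And>i. i < N x \<Longrightarrow> g (w i) (prod_encode (x, i)) = 0"
        using g(2)[of "prod_encode (x, _)"] by simp metis
      show "\<exists>y. \<forall>i<N x. g (cnth y i) (prod_encode (x, i)) = 0"
        by (rule exI[of _ "list_encode (map w [0..<N x])"]) (simp add: w)
    next
      assume "\<exists>y. \<forall>i<N x. g (cnth y i) (prod_encode (x, i)) = 0"
      then show "\<forall>i<N x. P x i" using g(2)[of "prod_encode (x, _)"] by auto
    qed
    then show "(\<forall>i<N x. P x i) \<longleftrightarrow> (\<exists>y. (\<Sum>i<N x. g (cnth y i) (prod_encode (x, i))) = 0)"
      by (simp add: Ball_def)
  qed
qed

abbreviation lset :: "nat \<Rightarrow> nat set" where "lset c \<equiv> set (list_decode c)"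

text \<open>A list is no longer than its code, so the code bounds the index. Members are thereby
  described with a bounded index through \<open>cdrop\<close> and \<open>cnth\<close>, without
  computing the length.\<close>

lemma lset_conv: "lset c = {cnth c i | i. i < c \<and> cdrop i c \<noteq> 0}"
proof -
  have "length (list_decode c) \<le> c" using length_le_list_encode[of "list_decode c"] by simp
  then have "i < c \<and> cdrop i c \<noteq> 0 \<longleftrightarrow> i < length (list_decode c)" for i
    by auto
  then show ?thesis
    unfolding set_conv_nth by (metis (no_types, lifting) cnth_decode)
qed

lemma semidec_Ball_lset [semi_intros]:
  assumes "recursive F" "semidec (\<lambda>z. P (pfst z) (psnd z))"
  shows "semidec (\<lambda>x. \<forall>y\<in>lset (F x). P x y)"
proof -
  have "semidec (\<lambda>x. \<forall>i<F x. cdrop i (F x) = 0 \<or> P x (cnth (F x) i))"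
    by (intro semi_intros rec_intros assms recursive_comp[OF assms(1)] semidec_comp2[OF assms(2)])
  moreover have "(\<forall>i<c. cdrop i c = 0 \<or> Q (cnth c i)) \<longleftrightarrow> (\<forall>y\<in>lset c. Q y)" for c Q
    by (auto simp: lset_conv simp del: cdrop_eq_0)
  ultimately show ?thesis by simp
qed

lemma semidec_mem [semi_intros]:
  assumes "recursive F" "recursive G"
  shows "semidec (\<lambda>x. G x \<in> lset (F x))"
proof -
  have "semidec (\<lambda>x. \<exists>i. i < F x \<and> cdrop i (F x) \<noteq> 0 \<and> G x = cnth (F x) i)"
    by (intro semi_intros rec_intros recursive_comp[OF assms(1)] recursive_comp[OF assms(2)])
  moreover have "a \<in> lset c \<longleftrightarrow> (\<exists>i. i < c \<and> cdrop i c \<noteq> 0 \<and> a = cnth c i)" for a c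
    unfolding lset_conv by blast
  ultimately show ?thesis by simp
qed

lemma semidec_notin [semi_intros]:
  assumes "recursive F" "recursive G"
  shows "semidec (\<lambda>x. G x \<notin> lset (F x))"
proof -
  have "semidec (\<lambda>x. \<forall>y\<in>lset (F x). G x \<noteq> y)"
    by (intro semi_intros rec_intros assms recursive_comp[OF assms(2)])
  moreover have "a \<notin> lset c \<longleftrightarrow> (\<forall>y\<in>lset c. a \<noteq> y)" for a c by auto
  ultimately show ?thesis by simp
qed

lemma semidec_Bex_lset [semi_intros]:
  assumes "recursive F" "semidec (\<lambda>z. P (pfst z) (psnd z))"
  shows "semidec (\<lambda>x. \<exists>y\<in>lset (F x). P x y)"
  unfolding Bex_def by (intro semi_intros rec_intros recursive_comp[OF assms(1)] assms)

lemma semidec_lset_subset [semi_intros]: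
  assumes "recursive F" "recursive G"
  shows "semidec (\<lambda>x. lset (F x) \<subseteq> lset (G x))"
  unfolding subset_eq by (intro semi_intros rec_intros assms recursive_comp[OF assms(2)])

lemma semidec_length [semi_intros]:
  assumes "recursive F" "recursive N"
  shows "semidec (\<lambda>x. length (list_decode (F x)) = N x)"
proof -
  have "semidec (\<lambda>x. cdrop (N x) (F x) = 0 \<and> (\<forall>m<N x. cdrop m (F x) \<noteq> 0))"
    by (intro semi_intros rec_intros assms recursive_comp[OF assms(1)])
  moreover have "cdrop n c = 0 \<and> (\<forall>m<n. cdrop m c \<noteq> 0) \<longleftrightarrow> length (list_decode c) = n" for c n
    by (auto simp: not_le intro!: le_antisym leI)
  ultimately show ?thesis by simp
qed

text \<open>A quantifier over tuples of fixed length is a nest of bounded quantifiers. Peeling off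
  the first entry changes the predicate, so the induction on \<open>k\<close> generalises
  \<open>P\<close>.\<close>

lemma semidec_all_lists:
  assumes "recursive F" "semidec (\<lambda>z. P (pfst z) (psnd z))"
  shows "semidec (\<lambda>x. \<forall>as. length as = k \<longrightarrow> set as \<subseteq> lset (F x) \<longrightarrow> P x (list_encode as))"
  using assms(2)
proof (induction k arbitrary: P)
  case 0
  then show ?case using semidec_comp2[OF 0 recursive_id recursive_const[of 0]] by simp
next
  case (Suc k)
  have "semidec (\<lambda>x. \<forall>as. length as = k \<longrightarrow> set as \<subseteq> lset (F x) \<longrightarrow>
          (\<forall>a\<in>lset (F x). P x (Suc (prod_encode (a, list_encode as)))))"
    by (intro Suc.IH semi_intros semidec_comp2[OF Suc.prems] rec_intros recursive_comp[OF assms(1)])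
  moreover have "(\<forall>as. length as = k \<longrightarrow> set as \<subseteq> U \<longrightarrow>
          (\<forall>a\<in>U. Q (Suc (prod_encode (a, list_encode as))))) \<longleftrightarrow>
     (\<forall>as. length as = Suc k \<longrightarrow> set as \<subseteq> U \<longrightarrow> Q (list_encode as))" for U Q
  proof (safe, goal_cases)
    case (1 as)
    then show ?case by (cases as) auto
  next
    case (2 as a)
    then show ?case using 2(1)[rule_format, of "a # as"] by simp
  qed
  ultimately show ?case by simp
qed

subsection \<open>Computably enumerable sets are the semidecidable ones\<close>

lemma list_decode_Cons: "list_decode (Suc (prod_encode (a, c))) = a # list_decode c"
  by simp

lemma decode_conv_ctl: "c \<noteq> 0 \<Longrightarrow> list_decode c = cnth c 0 # list_decode (ctl c)"
  by (cases c) (auto simp: cnth_def cdrop_def ctl_def pfst_def psnd_def split: prod.splits)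

text \<open>The code \<open>w\<close> holds the whole course of values. This replaces the recursion
  by an existential quantifier over numbers and a bounded universal one, both of which semidecidable
  predicates admit.\<close>

lemma reval_RPrec_iff:
  "reval (RPrec f g) (n # xs) y \<longleftrightarrow>
    (\<exists>w. reval f xs (cnth w 0) \<and> (\<forall>i<n. reval g (i # cnth w i # xs) (cnth w (Suc i))) \<and> y = cnth w n)"
proof
  have "\<exists>ws. length ws = Suc n \<and> reval f xs (ws ! 0) \<and>
    (\<forall>i<n. reval g (i # ws ! i # xs) (ws ! Suc i)) \<and> y = ws ! n"
    if "reval (RPrec f g) (n # xs) y"
    using that
  proof (induction n arbitrary: y)
    case 0
    then have "reval f xs y" by (auto elim!: reval_elims)
    then show ?case by (intro exI[of _ "[y]"]) auto
  next
    case (Suc n)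
    then obtain v where v: "reval (RPrec f g) (n # xs) v" "reval g (n # v # xs) y"
      by (auto elim!: reval_elims)
    from Suc.IH[OF v(1)] obtain ws where ws: "length ws = Suc n" "reval f xs (ws ! 0)"
      "\<forall>i<n. reval g (i # ws ! i # xs) (ws ! Suc i)" "v = ws ! n" by blast
    then show ?case using v(2)
      by (intro exI[of _ "ws @ [y]"]) (auto simp: nth_append less_Suc_eq)
  qed
  moreover assume "reval (RPrec f g) (n # xs) y"
  ultimately obtain ws where ws: "length ws = Suc n" "reval f xs (ws ! 0)"
    "\<forall>i<n. reval g (i # ws ! i # xs) (ws ! Suc i)" "y = ws ! n" by blast
  then show "\<exists>w. reval f xs (cnth w 0) \<and>
      (\<forall>i<n. reval g (i # cnth w i # xs) (cnth w (Suc i))) \<and> y = cnth w n"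
    by (intro exI[of _ "list_encode ws"]) simp
next
  assume "\<exists>w. reval f xs (cnth w 0) \<and>
      (\<forall>i<n. reval g (i # cnth w i # xs) (cnth w (Suc i))) \<and> y = cnth w n"
  then obtain w where w: "reval f xs (cnth w 0)"
      "\<forall>i<n. reval g (i # cnth w i # xs) (cnth w (Suc i))" "y = cnth w n" by blast
  have "m \<le> n \<Longrightarrow> reval (RPrec f g) (m # xs) (cnth w m)" for m
    by (induction m) (use w in \<open>auto intro: reval.prec0 reval.precS\<close>)
  then show "reval (RPrec f g) (n # xs) y" using w by simp
qed

text \<open>Argument lists are coded because arities vary between subprograms. Composition guesses
  the list of inner values, primitive recursion its course of values, and minimisation is a bounded
  universal quantifier over an existential one. The empty argument list is split off for the
  programs that are undefined on it.\<close>

lemma semidec_reval: "semidec (\<lambda>z. reval f (list_decode (pfst z)) (psnd z))"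
proof (induction f)
  case RZero
  have "reval RZero xs y \<longleftrightarrow> y = 0" for xs y by (auto elim!: reval_elims intro: reval.zero)
  then show ?case by (simp only: list_all2_Nil) (intro semi_intros rec_intros)
next
  case RSucc
  have "reval RSucc (list_decode c) y \<longleftrightarrow> c \<noteq> 0 \<and> y = Suc (cnth c 0)" for c y
  proof (cases "c = 0")
    case True
    then show ?thesis by (auto elim!: reval_elims)
  next
    case False
    show ?thesis unfolding decode_conv_ctl[OF False] using False
      by (auto elim!: reval_elims intro: reval.succ)
  qed
  then show ?case by (simp only:) (intro semi_intros rec_intros)
next
  case (RProj i)
  have "reval (RProj i) (list_decode c) y \<longleftrightarrow> cdrop i c \<noteq> 0 \<and> y = cnth c i" for c y
    by (auto elim!: reval_elims intro!: reval_proj simp: cnth_decode)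
  then show ?case by (simp only:) (intro semi_intros rec_intros)
next
  case (RComp f gs)
  have gs: "semidec (\<lambda>z. list_all2 (\<lambda>g y. reval g (list_decode (pfst z)) y) gs (list_decode (psnd z)))"
    using RComp.IH(2)
  proof (induction gs)
    case Nil
    have "list_decode c = [] \<longleftrightarrow> c = 0" for c
      by (metis list_decode.simps(1) list_decode_inverse list_encode_eq_0)
    then show ?case by (simp only: list_all2_Nil) (intro semi_intros rec_intros)
  next
    case (Cons g gs)
    have eq: "list_all2 R (g # gs) (list_decode d) \<longleftrightarrow>
        d \<noteq> 0 \<and> R g (cnth d 0) \<and> list_all2 R gs (list_decode (ctl d))" for R d
    proof (cases "d = 0")
      case False
      then show ?thesis by (simp add: decode_conv_ctl[OF False])
    qed simp
    have g: "semidec (\<lambda>z. reval g (list_decode (pfst z)) (psnd z))"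
      using Cons.prems by simp
    have gs: "semidec (\<lambda>z. list_all2 (\<lambda>g y. reval g (list_decode (pfst z)) y) gs (list_decode (psnd z)))"
      using Cons by simp
    show ?case unfolding eq
      by (intro semi_intros rec_intros semidec_comp2[OF g] semidec_comp2[OF gs])
  qed
  have "reval (RComp f gs) xs y \<longleftrightarrow> (\<exists>d. list_all2 (\<lambda>g y. reval g xs y) gs (list_decode d)
      \<and> reval f (list_decode d) y)" for xs y
  proof
    assume "reval (RComp f gs) xs y"
    then obtain ys where "length ys = length gs" "\<forall>i<length gs. reval (gs ! i) xs (ys ! i)"
      "reval f ys y" by (auto elim!: reval_elims)
    then show "\<exists>d. list_all2 (\<lambda>g y. reval g xs y) gs (list_decode d) \<and> reval f (list_decode d) y"
      by (intro exI[of _ "list_encode ys"]) (simp add: list_all2_conv_all_nth)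
  qed (auto simp: list_all2_conv_all_nth intro: reval.comp)
  then show ?case
    by (simp only:) (intro semi_intros rec_intros semidec_comp2[OF gs] semidec_comp2[OF RComp.IH(1)])
next
  case (RPrec f g)
  have eq: "reval (RPrec f g) (list_decode c) y \<longleftrightarrow> c \<noteq> 0 \<and>
    (\<exists>w. reval f (list_decode (ctl c)) (cnth w 0) \<and>
      (\<forall>i<cnth c 0. reval g (list_decode (Suc (prod_encode (i, Suc (prod_encode (cnth w i, ctl c))))))
        (cnth w (Suc i))) \<and> y = cnth w (cnth c 0))" for c y
  proof (cases "c = 0")
    case True
    then show ?thesis by (auto elim!: reval_elims)
  next
    case False
    show ?thesis unfolding decode_conv_ctl[OF False] reval_RPrec_iff using False
      by (simp del: list_decode.simps add: list_decode_Cons)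
  qed
  show ?case unfolding eq
    by (intro semi_intros rec_intros semidec_comp2[OF RPrec.IH(1)] semidec_comp2[OF RPrec.IH(2)])
next
  case (RMu f)
  have eq: "reval (RMu f) (list_decode c) n \<longleftrightarrow>
      reval f (list_decode (Suc (prod_encode (n, c)))) 0 \<and>
      (\<forall>m<n. \<exists>y. reval f (list_decode (Suc (prod_encode (m, c)))) y \<and> 0 < y)" for c n
    by (auto elim!: reval_elims intro: reval.mu)
  show ?case unfolding eq
    by (intro semi_intros rec_intros semidec_comp2[OF RMu.IH])
qed

lemma ce_set_iff_semidec: "ce_set A \<longleftrightarrow> semidec (\<lambda>x. x \<in> A)"
proof
  assume "ce_set A"
  then obtain f where f: "\<And>x. x \<in> A \<longleftrightarrow> (\<exists>y. reval f [x] y)" unfolding ce_set_def by blast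
  have "semidec (\<lambda>x. \<exists>y. reval f (list_decode (Suc (prod_encode (x, 0)))) y)"
    by (intro semi_intros rec_intros semidec_comp2[OF semidec_reval])
  then show "semidec (\<lambda>x. x \<in> A)" by (simp add: f)
next
  assume "semidec (\<lambda>x. x \<in> A)"
  then obtain F where F: "recursive F" "\<And>x. x \<in> A \<longleftrightarrow> (\<exists>y. F (prod_encode (y, x)) = 0)"
    unfolding semidec_def by blast
  from F(1) obtain g where g: "\<And>x. reval g [x] (F x)" unfolding recursive_def by blast
  \<comment> \<open>Unbounded search as a program: \<open>F\<close> is total, so
    \<open>RMu h\<close> halts on \<open>x\<close> exactly if some \<open>y\<close> gives the value
    0. The search variable comes first, as \<open>RMu\<close> puts it at the head of the
    list.\<close>
  define h where "h = RComp g [R_pair]"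
  have h: "reval h [y, x] v \<longleftrightarrow> v = F (prod_encode (y, x))" for x y v
    unfolding h_def using reval_comp1[OF reval_pair g] reval_det by blast
  have "x \<in> A \<longleftrightarrow> (\<exists>y. reval (RMu h) [x] y)" for x
  proof
    assume "x \<in> A"
    then obtain y where y: "F (prod_encode (y, x)) = 0" using F(2) by blast
    define n where "n = (LEAST y. F (prod_encode (y, x)) = 0)"
    have "F (prod_encode (n, x)) = 0" using y unfolding n_def by (rule LeastI)
    moreover have "F (prod_encode (m, x)) > 0" if "m < n" for m
      using that not_less_Least unfolding n_def by blast
    ultimately show "\<exists>y. reval (RMu h) [x] y" by (intro exI[of _ n] reval.mu) (auto simp: h)
  next
    assume "\<exists>y. reval (RMu h) [x] y"
    then show "x \<in> A" by (auto elim!: reval_elims simp: h F(2))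
  qed
  then show "ce_set A" unfolding ce_set_def by blast
qed


subsection \<open>Atomic diagrams and isomorphisms\<close>

lemma diag_simps [simp]:
  "(True, AEq a b) \<in> diag sig M \<longleftrightarrow> a = b \<and> a \<in> fst M"
  "(False, AEq a b) \<in> diag sig M \<longleftrightarrow> a \<noteq> b \<and> a \<in> fst M \<and> b \<in> fst M"
  "(True, ARel i as) \<in> diag sig M \<longleftrightarrow> snd M i as"
  "(False, ARel i as) \<in> diag sig M \<longleftrightarrow>
     i < length sig \<and> length as = sig ! i \<and> set as \<subseteq> fst M \<and> \<not> snd M i as"
  by (auto simp: diag_def)

lemma is_structD:
  assumes "is_struct sig M" "snd M i as"
  shows "i < length sig" "length as = sig ! i" "set as \<subseteq> fst M"
  using assms unfolding is_struct_def by blast+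

lemma literal_cases [case_names Eq Neq Rel NRel]:
  fixes l :: literal
  obtains a b where "l = (True, AEq a b)" | a b where "l = (False, AEq a b)"
    | i as where "l = (True, ARel i as)" | i as where "l = (False, ARel i as)"
proof -
  obtain b a where "l = (b, a)" by (cases l)
  then show ?thesis using that by (cases b; cases a) auto
qed

text \<open>Positive relation literals give preservation of relations and negative ones reflection.
  This is the bridge by which monotone operators on diagrams respect substructures.\<close>

lemma diag_subset_iff:
  assumes "is_struct sig A" "is_struct sig C"
  shows "diag sig A \<subseteq> diag sig C \<longleftrightarrow> substructure A C"
proof
  assume sub: "diag sig A \<subseteq> diag sig C"
  have "fst A \<subseteq> fst C"
  proof
    fix a assume "a \<in> fst A"
    then have "(True, AEq a a) \<in> diag sig C" by (intro subsetD[OF sub]) simp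
    then show "a \<in> fst C" by simp
  qed
  moreover have "snd A i as \<longleftrightarrow> snd C i as" if as: "set as \<subseteq> fst A" for i as
  proof
    assume "snd A i as"
    then have "(True, ARel i as) \<in> diag sig C" by (intro subsetD[OF sub]) simp
    then show "snd C i as" by simp
  next
    assume C: "snd C i as"
    show "snd A i as"
    proof (rule ccontr)
      assume "\<not> snd A i as"
      then have "(False, ARel i as) \<in> diag sig C"
        using as is_structD[OF assms(2) C] by (intro subsetD[OF sub]) simp
      then show False using C by simp
    qed
  qed
  ultimately show "substructure A C" by (simp add: substructure_def)
next
  assume "substructure A C"
  then have C: "fst A \<subseteq> fst C" "\<And>i as. set as \<subseteq> fst A \<Longrightarrow> snd A i as \<longleftrightarrow> snd C i as"
    by (auto simp: substructure_def)
  show "diag sig A \<subseteq> diag sig C"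
  proof
    fix l assume l: "l \<in> diag sig A"
    show "l \<in> diag sig C"
    proof (cases l rule: literal_cases)
      case (Rel i as)
      then show ?thesis using l C(2)[of as] is_structD(3)[OF assms(1)] by auto
    qed (use l C in auto)
  qed
qed

lemma substructure_antisym:
  assumes "is_struct sig A" "is_struct sig B" "substructure A B" "substructure B A"
  shows "A = B"
proof (rule prod_eqI)
  show fst: "fst A = fst B" using assms by (auto simp: substructure_def)
  show "snd A = snd B"
  proof (intro ext)
    fix i as
    show "snd A i as = snd B i as"
      using assms(3) is_structD(3)[OF assms(1), of i as] is_structD(3)[OF assms(2), of i as] fst
      unfolding substructure_def by auto
  qed
qed

lemma diag_inject:
  assumes "is_struct sig A" "is_struct sig B" "diag sig A = diag sig B"
  shows "A = B"
  using assms diag_subset_iff[of sig A B] diag_subset_iff[of sig B A] substructure_antisym[of sig A B]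
  by simp

section \<open>Finite supports of literals and of outputs\<close>

fun lit_consts :: "literal \<Rightarrow> nat set" where
  "lit_consts (b, AEq a c) = {a, c}"
| "lit_consts (b, ARel i as) = set as"

lemma finite_lit_consts [simp]: "finite (lit_consts l)"
  by (cases l rule: literal_cases) auto

lemma lit_consts_diag:
  assumes "is_struct sig A" "l \<in> diag sig A"
  shows "lit_consts l \<subseteq> fst A"
proof (cases l rule: literal_cases)
  case (Rel i as)
  then show ?thesis using assms(2) is_structD(3)[OF assms(1), of i as] by simp
qed (use assms(2) in auto)

lemma finite_diag:
  assumes "is_struct sig A" "finite (fst A)"
  shows "finite (diag sig A)"
proof -
  let ?R = "\<Union>i<length sig. ARel i ` {as. set as \<subseteq> fst A \<and> length as = sig ! i}"
  let ?E = "(\<lambda>(a, b). AEq a b) ` (fst A \<times> fst A)"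
  have "finite (UNIV \<times> (?R \<union> ?E) :: literal set)"
    using assms(2) by (intro finite_cartesian_product finite_UnI finite_UN_I finite_imageI
        finite_lists_length_eq) auto
  moreover have "diag sig A \<subseteq> UNIV \<times> (?R \<union> ?E)"
  proof
    fix l assume "l \<in> diag sig A"
    then show "l \<in> UNIV \<times> (?R \<union> ?E)"
    proof (cases l rule: literal_cases)
      case (Rel i as)
      then have "snd A i as" using \<open>l \<in> diag sig A\<close> by simp
      from is_structD[OF assms(1) this] show ?thesis unfolding Rel by auto
    qed auto
  qed
  ultimately show ?thesis by (rule finite_subset[rotated])
qed

definition restr :: "struct \<Rightarrow> nat set \<Rightarrow> struct" where
  "restr A U = (U, \<lambda>i as. snd A i as \<and> set as \<subseteq> U)"

text \<open>The language is relational, so every nonempty set of elements carries a substructure;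
  the elements named in \<open>X\<close> suffice.\<close>

lemma finite_support_diag:
  assumes A: "is_struct sig A" and X: "finite X" "X \<subseteq> diag sig A"
  obtains A0 where "is_struct sig A0" "finite (fst A0)" "substructure A0 A" "X \<subseteq> diag sig A0"
proof -
  obtain a where a: "a \<in> fst A" using A by (auto simp: is_struct_def)
  \<comment> \<open>\<open>a\<close> keeps the universe nonempty when \<open>X\<close> is
    empty.\<close>
  define U where "U = insert a (\<Union> (lit_consts ` X))"
  have U: "finite U" "U \<subseteq> fst A" "a \<in> U"
    using X a lit_consts_diag[OF A] by (auto simp: U_def)
  have "is_struct sig (restr A U)" using is_structD[OF A] U by (auto simp: is_struct_def restr_def)
  moreover have "substructure (restr A U) A" using U by (auto simp: substructure_def restr_def)
  moreover have "X \<subseteq> diag sig (restr A U)"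
  proof
    fix l assume l: "l \<in> X"
    then have "lit_consts l \<subseteq> U" by (auto simp: U_def)
    then show "l \<in> diag sig (restr A U)"
      using subsetD[OF X(2) l] by (cases l rule: literal_cases) (auto simp: restr_def)
  qed
  ultimately show ?thesis using that[of "restr A U"] U(1) by (simp add: restr_def)
qed

lemma apply_transf_mono: "diag sig A \<subseteq> diag sig C \<Longrightarrow> apply_transf \<Phi> sig A \<subseteq> apply_transf \<Phi> sig C"
  by (auto simp: apply_transf_def)

text \<open>The use principle: each literal in \<open>Y\<close> is produced from one finite
  \<open>\<alpha>\<close>, and the union of these over a finite \<open>Y\<close> is finite.\<close>

lemma finite_support_apply:
  assumes A: "is_struct sig A" and Y: "finite Y" "Y \<subseteq> apply_transf \<Phi> sig A"
  obtains A0 where "is_struct sig A0" "finite (fst A0)" "substructure A0 A"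
    "Y \<subseteq> apply_transf \<Phi> sig A0"
proof -
  have "\<forall>y\<in>Y. \<exists>\<alpha>. (\<alpha>, y) \<in> \<Phi> \<and> set \<alpha> \<subseteq> diag sig A"
    using Y(2) by (auto simp: apply_transf_def)
  then obtain \<alpha> where \<alpha>: "\<And>y. y \<in> Y \<Longrightarrow> (\<alpha> y, y) \<in> \<Phi>" "\<And>y. y \<in> Y \<Longrightarrow> set (\<alpha> y) \<subseteq> diag sig A"
    by metis
  have "finite (\<Union>y\<in>Y. set (\<alpha> y))" "(\<Union>y\<in>Y. set (\<alpha> y)) \<subseteq> diag sig A"
    using Y(1) \<alpha>(2) by auto
  then obtain A0 where A0: "is_struct sig A0" "finite (fst A0)" "substructure A0 A"
    "(\<Union>y\<in>Y. set (\<alpha> y)) \<subseteq> diag sig A0" using finite_support_diag[OF A] by metis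
  have "Y \<subseteq> apply_transf \<Phi> sig A0"
    using \<alpha>(1) A0(4) by (fastforce simp: apply_transf_def)
  then show ?thesis using that A0 by blast
qed

section \<open>Isomorphic copies and preservation of existential sentences\<close>

lemma iso_sym:
  assumes "iso A B" shows "iso B A"
proof -
  obtain f where f: "bij_betw f (fst A) (fst B)"
    "\<And>i as. set as \<subseteq> fst A \<Longrightarrow> snd A i as \<longleftrightarrow> snd B i (map f as)"
    using assms unfolding iso_def by blast
  let ?g = "inv_into (fst A) f"
  have g: "bij_betw ?g (fst B) (fst A)" using f(1) by (rule bij_betw_inv_into)
  moreover have "snd B i bs \<longleftrightarrow> snd A i (map ?g bs)" if "set bs \<subseteq> fst B" for i bs
  proof -
    have "map f (map ?g bs) = bs"
      using that f(1) by (auto simp: map_idI bij_betw_inv_into_right subset_eq)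
    moreover have "set (map ?g bs) \<subseteq> fst A" using that g by (auto simp: bij_betw_def)
    ultimately show ?thesis using f(2)[of "map ?g bs" i] by simp
  qed
  ultimately show ?thesis unfolding iso_def by blast
qed

lemma iso_trans:
  assumes "iso A B" "iso B C" shows "iso A C"
proof -
  obtain f where f: "bij_betw f (fst A) (fst B)"
    "\<And>i as. set as \<subseteq> fst A \<Longrightarrow> snd A i as \<longleftrightarrow> snd B i (map f as)"
    using assms(1) unfolding iso_def by blast
  obtain g where g: "bij_betw g (fst B) (fst C)"
    "\<And>i as. set as \<subseteq> fst B \<Longrightarrow> snd B i as \<longleftrightarrow> snd C i (map g as)"
    using assms(2) unfolding iso_def by blast
  have "snd A i as \<longleftrightarrow> snd C i (map (g \<circ> f) as)" if "set as \<subseteq> fst A" for i as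
  proof -
    have "set (map f as) \<subseteq> fst B" using that f(1) by (auto simp: bij_betw_def)
    then show ?thesis using f(2)[OF that] g(2)[of "map f as" i] by simp
  qed
  then show ?thesis unfolding iso_def using bij_betw_trans[OF f(1) g(1)] by blast
qed

lemma iso_card: "iso A B \<Longrightarrow> card (fst A) = card (fst B)"
  unfolding iso_def using bij_betw_same_card by blast

definition image_struct :: "(nat \<Rightarrow> nat) \<Rightarrow> struct \<Rightarrow> struct" where
  "image_struct f A = (f ` fst A, \<lambda>i bs. \<exists>as. set as \<subseteq> fst A \<and> snd A i as \<and> bs = map f as)"

lemma is_struct_image: "is_struct sig A \<Longrightarrow> is_struct sig (image_struct f A)"
  unfolding is_struct_def image_struct_def by fastforce

lemma image_struct_rel:
  assumes "inj_on f (fst A)" "set as \<subseteq> fst A"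
  shows "snd A i as \<longleftrightarrow> snd (image_struct f A) i (map f as)"
proof
  assume "snd (image_struct f A) i (map f as)"
  then obtain cs where cs: "set cs \<subseteq> fst A" "snd A i cs" "map f as = map f cs"
    by (auto simp: image_struct_def)
  have "as = cs"
    using map_inj_on[OF cs(3)] inj_on_subset[OF assms(1)] assms(2) cs(1) by auto
  then show "snd A i as" using cs by simp
qed (use assms in \<open>auto simp: image_struct_def\<close>)

lemma iso_image_struct:
  assumes "inj_on f (fst A)" shows "iso A (image_struct f A)"
proof -
  have "bij_betw f (fst A) (fst (image_struct f A))"
    using assms by (simp add: image_struct_def bij_betw_def)
  then show ?thesis unfolding iso_def using image_struct_rel[OF assms] by blast
qed

lemma eval_fm_map:
  assumes "\<And>i as. set as \<subseteq> fst A \<Longrightarrow> snd A i as \<longleftrightarrow> J i (map f as)" "inj_on f (fst A)"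
    "set as \<subseteq> fst A" "wf_fm sig (length as) p"
  shows "eval_fm J (map f as) p \<longleftrightarrow> eval_fm (snd A) as p"
  using assms(4)
proof (induction p)
  case (FEq i j)
  then have "as ! i \<in> fst A" "as ! j \<in> fst A" using assms(3) by (auto intro: nth_mem)
  then show ?case using FEq assms(2) by (auto dest: inj_onD)
next
  case (FRel r vs)
  have "set (map (\<lambda>v. as ! v) vs) \<subseteq> fst A" using FRel assms(3) by (auto intro: nth_mem)
  moreover have "map (\<lambda>v. map f as ! v) vs = map f (map (\<lambda>v. as ! v) vs)" using FRel by auto
  ultimately show ?case using assms(1)[of "map (\<lambda>v. as ! v) vs" r]
    by (simp del: map_map map_eq_conv)
qed auto

text \<open>Quantifier-free formulas are invariant under embeddings, so a witness tuple can be
  pushed forward. Isomorphisms and inclusions are the two cases needed later.\<close>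

lemma sat_ex_embedding:
  assumes "\<And>i as. set as \<subseteq> fst A \<Longrightarrow> snd A i as \<longleftrightarrow> snd B i (map f as)" "inj_on f (fst A)"
    "f ` fst A \<subseteq> fst B" "wf_ex sig s" "sat_ex A s"
  shows "sat_ex B s"
proof -
  obtain as where as: "length as = fst s" "set as \<subseteq> fst A" "eval_fm (snd A) as (snd s)"
    using assms(5) by (auto simp: sat_ex_def)
  then have "eval_fm (snd B) (map f as) (snd s)"
    using eval_fm_map[of A "snd B" f as sig "snd s"] assms by (simp add: wf_ex_def)
  then show ?thesis unfolding sat_ex_def using as assms(3)
    by (intro exI[of _ "map f as"]) auto
qed

lemma sat_ex_iso: "iso A B \<Longrightarrow> wf_ex sig s \<Longrightarrow> sat_ex A s \<Longrightarrow> sat_ex B s"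
  unfolding iso_def using sat_ex_embedding[of A B _ sig s] by (auto simp: bij_betw_def)

lemma sat_ex_mono: "substructure A B \<Longrightarrow> wf_ex sig s \<Longrightarrow> sat_ex A s \<Longrightarrow> sat_ex B s"
  using sat_ex_embedding[of A B id sig s] by (auto simp: substructure_def)

subsection \<open>Finite linear orders\<close>

lemma FLO_struct: "B \<in> FLO \<Longrightarrow> is_struct LO_sig B" "B \<in> FLO \<Longrightarrow> finite (fst B)"
  by (simp_all add: FLO_def)

lemma FLO_substructure_antisym: "A \<in> FLO \<Longrightarrow> B \<in> FLO \<Longrightarrow> substructure A B \<Longrightarrow> substructure B A \<Longrightarrow> A = B"
  using substructure_antisym FLO_struct(1) by blast

definition std_order :: "nat \<Rightarrow> struct" where
  "std_order n = ({..<n}, \<lambda>i as. i = 0 \<and> length as = 2 \<and> set as \<subseteq> {..<n} \<and> as ! 0 \<le> as ! 1)"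

lemma std_order_FLO: "n > 0 \<Longrightarrow> std_order n \<in> FLO"
  by (auto simp: std_order_def FLO_def is_struct_def LO_sig_def lessThan_empty_iff)

text \<open>The isomorphism counts strict predecessors. Strict monotonicity follows because the
  predecessors of a smaller element form a proper subset; it gives injectivity, and equal finite
  cardinality then gives surjectivity.\<close>

lemma FLO_iso_std_order:
  assumes B: "B \<in> FLO"
  shows "iso B (std_order (card (fst B)))"
proof -
  define le where "le a b \<longleftrightarrow> snd B 0 [a, b]" for a b
  note o = B[unfolded FLO_def mem_Collect_eq, folded le_def]
  define r where "r a = card {b \<in> fst B. le b a \<and> b \<noteq> a}" for a
  have fin: "finite {b \<in> fst B. P b}" for P using o by simp
  have less: "r a < r b" if "a \<in> fst B" "b \<in> fst B" "le a b" "a \<noteq> b" for a b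
    unfolding r_def
  proof (rule psubset_card_mono[OF fin])
    have "{c \<in> fst B. le c a \<and> c \<noteq> a} \<subseteq> {c \<in> fst B. le c b \<and> c \<noteq> b}"
      using o that by blast
    moreover have "a \<in> {c \<in> fst B. le c b \<and> c \<noteq> b} - {c \<in> fst B. le c a \<and> c \<noteq> a}"
      using that by simp
    ultimately show "{c \<in> fst B. le c a \<and> c \<noteq> a} \<subset> {c \<in> fst B. le c b \<and> c \<noteq> b}" by blast
  qed
  have le_iff: "le a b \<longleftrightarrow> r a \<le> r b" if "a \<in> fst B" "b \<in> fst B" for a b
    using less[of a b] less[of b a] that o by (metis leD less_imp_le order_refl)
  have inj: "inj_on r (fst B)"
    using o le_iff by (intro inj_onI) (metis order_refl)
  have "r a < card (fst B)" if "a \<in> fst B" for a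
  proof -
    have "{b \<in> fst B. le b a \<and> b \<noteq> a} \<subset> fst B" using that by blast
    then show ?thesis unfolding r_def using FLO_struct(2)[OF B] by (rule psubset_card_mono[rotated])
  qed
  then have "r ` fst B \<subseteq> {..<card (fst B)}" by auto
  then have "r ` fst B = {..<card (fst B)}"
    by (intro card_subset_eq) (auto simp: card_image inj)
  then have bij: "bij_betw r (fst B) {..<card (fst B)}" using inj by (simp add: bij_betw_def)
  have "snd B i as \<longleftrightarrow> snd (std_order (card (fst B))) i (map r as)" if as: "set as \<subseteq> fst B" for i as
  proof (cases "i = 0 \<and> length as = 2")
    case True
    then obtain a b where ab: "as = [a, b]" by (auto simp: numeral_2_eq_2 length_Suc_conv)
    have "r a < card (fst B)" "r b < card (fst B)" using bij as ab by (auto simp: bij_betw_def)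
    then show ?thesis using True ab as le_iff[of a b] by (simp add: std_order_def le_def)
  next
    case False
    then show ?thesis using is_structD[OF FLO_struct(1)[OF B], of i as]
      by (auto simp: std_order_def LO_sig_def)
  qed
  then show ?thesis unfolding iso_def using bij by (auto simp: std_order_def)
qed

lemma FLO_iso_iff_card:
  assumes "A \<in> FLO" "B \<in> FLO"
  shows "iso A B \<longleftrightarrow> card (fst A) = card (fst B)"
  using FLO_iso_std_order[OF assms(1)] FLO_iso_std_order[OF assms(2)] iso_sym iso_trans iso_card
  by metis

subsection \<open>Coded diagrams\<close>

lemma inj_enc_lit: "inj enc_lit"
proof (rule injI)
  fix l l' :: literal assume "enc_lit l = enc_lit l'"
  then show "l = l'"
    by (cases l rule: literal_cases; cases l' rule: literal_cases)
       (auto simp: list_encode_eq)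
qed

lemma enc_lit_mem_image [simp]: "enc_lit l \<in> enc_lit ` X \<longleftrightarrow> l \<in> X"
  using inj_enc_lit by (simp add: inj_image_mem_iff)

lemma list_decode_enc_lits [simp]: "list_decode (enc_lits xs) = map enc_lit xs"
  by (simp add: enc_lits_def)

text \<open>A diagram is presented by any list of its literals, in any order and with repetitions,
  so the coded conditions refer only to the set of entries of \<open>u\<close>.\<close>

lemma lset_eq_image_iff:
  "lset u = enc_lit ` X \<longleftrightarrow> (\<exists>xs. u = enc_lits xs \<and> set xs = X)"
proof
  assume u: "lset u = enc_lit ` X"
  then have "\<forall>c\<in>lset u. \<exists>l\<in>X. c = enc_lit l" by auto
  then obtain d where d: "\<And>c. c \<in> lset u \<Longrightarrow> d c \<in> X \<and> c = enc_lit (d c)" by metis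
  define xs where "xs = map d (list_decode u)"
  have "map enc_lit xs = list_decode u" unfolding xs_def using d by (simp add: map_idI)
  then have xs: "u = enc_lits xs" by (simp add: enc_lits_def)
  then have "enc_lit ` set xs = enc_lit ` X" using u by simp
  then have "set xs = X" using inj_enc_lit by (simp add: inj_image_eq_iff)
  then show "\<exists>xs. u = enc_lits xs \<and> set xs = X" using xs by blast
qed (auto simp del: enc_lit.simps)

text \<open>Unlike in \<open>semidec_all_less\<close>, each index may have its own procedure. It is
  applied to the relation symbols, where the number of nested quantifiers depends on the arity
  \<open>sig ! i\<close>.\<close>

lemma semidec_all_bounded_const:
  fixes n :: nat
  assumes "\<And>i. i < n \<Longrightarrow> semidec (P i)"
  shows "semidec (\<lambda>x. \<forall>i<n. P i x)"
  using assms
proof (induction n)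
  case (Suc n)
  have "semidec (\<lambda>x. P n x \<and> (\<forall>i<n. P i x))" using Suc by (intro semidec_conj) auto
  then show ?case by (simp add: All_less_Suc conj_commute)
qed (simp add: semidec_const)

text \<open>The universe is listed separately in \<open>w\<close>, so that quantifiers over elements
  become bounded by \<open>lset w\<close>.\<close>

definition codes_diag :: "nat list \<Rightarrow> nat \<Rightarrow> nat \<Rightarrow> bool" where
  "codes_diag sig w u \<longleftrightarrow>
    (\<exists>A. is_struct sig A \<and> fst A = lset w \<and> lset u = enc_lit ` diag sig A)"

lemma codes_diag_ex:
  "(\<exists>w. codes_diag sig w u) \<longleftrightarrow>
    (\<exists>A. is_struct sig A \<and> finite (fst A) \<and> lset u = enc_lit ` diag sig A)"
proof
  assume "\<exists>A. is_struct sig A \<and> finite (fst A) \<and> lset u = enc_lit ` diag sig A"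
  then obtain A us where "is_struct sig A" "fst A = set us" "lset u = enc_lit ` diag sig A"
    by (metis finite_list)
  then have "codes_diag sig (list_encode us) u"
    unfolding codes_diag_def by (intro exI[of _ A]) simp
  then show "\<exists>w. codes_diag sig w u" ..
qed (auto simp: codes_diag_def)

text \<open>The right side is arranged for the semidecidability rules: \<open>u\<close> has only
  literals over the listed universe, all equalities and inequalities that hold there, and exactly
  one sign of every relational atom. Exclusiveness is nonmembership in a finite list, which is
  decidable. Tuples appear as codes \<open>t\<close>, and the arity as a recursive function of
  \<open>i\<close>.\<close>

lemma codes_diag_iff:
  "codes_diag sig w u \<longleftrightarrow> w \<noteq> 0 \<and>
    (\<forall>l\<in>lset u. (\<exists>a\<in>lset w. l = enc_lit (True, AEq a a)) \<or>
       (\<exists>a\<in>lset w. \<exists>b\<in>lset w. a \<noteq> b \<and> l = enc_lit (False, AEq a b)) \<or>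
       (\<exists>i. i < length sig \<and> (\<exists>t. length (list_decode t) = cnth (list_encode sig) i \<and>
          lset t \<subseteq> lset w \<and> (l = prod_encode (1, prod_encode (1, prod_encode (i, t))) \<or>
            l = prod_encode (0, prod_encode (1, prod_encode (i, t))))))) \<and>
    (\<forall>a\<in>lset w. enc_lit (True, AEq a a) \<in> lset u) \<and>
    (\<forall>a\<in>lset w. \<forall>b\<in>lset w. a = b \<or> enc_lit (False, AEq a b) \<in> lset u) \<and>
    (\<forall>i<length sig. \<forall>as. length as = sig ! i \<longrightarrow> set as \<subseteq> lset w \<longrightarrow>
       enc_lit (True, ARel i as) \<in> lset u \<and> enc_lit (False, ARel i as) \<notin> lset u \<or>
       enc_lit (False, ARel i as) \<in> lset u \<and> enc_lit (True, ARel i as) \<notin> lset u)"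
  (is "_ \<longleftrightarrow> w \<noteq> 0 \<and> ?wf \<and> ?eq \<and> ?neq \<and> ?rel")
proof
  assume "codes_diag sig w u"
  then obtain A where A: "is_struct sig A" "fst A = lset w" "lset u = enc_lit ` diag sig A"
    unfolding codes_diag_def by blast
  have "w \<noteq> 0" using A(1,2) unfolding is_struct_def by (intro notI) simp
  moreover have ?wf
  proof
    fix c assume "c \<in> lset u"
    then obtain l where l: "c = enc_lit l" "l \<in> diag sig A" using A(3) by blast
    show "(\<exists>a\<in>lset w. c = enc_lit (True, AEq a a)) \<or>
       (\<exists>a\<in>lset w. \<exists>b\<in>lset w. a \<noteq> b \<and> c = enc_lit (False, AEq a b)) \<or>
       (\<exists>i. i < length sig \<and> (\<exists>t. length (list_decode t) = cnth (list_encode sig) i \<and>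
          lset t \<subseteq> lset w \<and> (c = prod_encode (1, prod_encode (1, prod_encode (i, t))) \<or>
            c = prod_encode (0, prod_encode (1, prod_encode (i, t))))))"
    proof (cases l rule: literal_cases)
      case (Eq a b)
      then show ?thesis using l A(2) by auto
    next
      case (Neq a b)
      then show ?thesis using l A(2) by auto
    next
      case (Rel i as)
      then show ?thesis using l A(2) is_structD[OF A(1), of i as]
        by (intro disjI2, intro exI[of _ i] conjI[OF _ exI[of _ "list_encode as"]]) auto
    next
      case (NRel i as)
      then show ?thesis using l A(2)
        by (intro disjI2, intro exI[of _ i] conjI[OF _ exI[of _ "list_encode as"]]) auto
    qed
  qed
  moreover have ?eq ?neq ?rel using A(2) by (auto simp: A(3) simp del: enc_lit.simps)
  ultimately show "w \<noteq> 0 \<and> ?wf \<and> ?eq \<and> ?neq \<and> ?rel" by blast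
next
  assume "w \<noteq> 0 \<and> ?wf \<and> ?eq \<and> ?neq \<and> ?rel"
  then have w: "w \<noteq> 0" and wf: ?wf and eq: ?eq and neq: ?neq and rel: ?rel
    by - (elim conjE, assumption)+
  define A :: struct where "A = (lset w, \<lambda>i as. i < length sig \<and> length as = sig ! i \<and>
      set as \<subseteq> lset w \<and> enc_lit (True, ARel i as) \<in> lset u)"
  have "lset w \<noteq> {}" using decode_conv_ctl[OF w] by simp
  then have A: "is_struct sig A" "fst A = lset w" by (auto simp: A_def is_struct_def)
  have "lset u \<subseteq> enc_lit ` diag sig A"
  proof
    fix c assume c: "c \<in> lset u"
    with wf consider a where "a \<in> lset w" "c = enc_lit (True, AEq a a)"
      | a b where "a \<in> lset w" "b \<in> lset w" "a \<noteq> b" "c = enc_lit (False, AEq a b)"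
      | i t where "i < length sig" "length (list_decode t) = cnth (list_encode sig) i"
          "lset t \<subseteq> lset w" "c = prod_encode (1, prod_encode (1, prod_encode (i, t))) \<or>
            c = prod_encode (0, prod_encode (1, prod_encode (i, t)))"
      by blast
    then show "c \<in> enc_lit ` diag sig A"
    proof cases
      case 1
      then show ?thesis using A by (auto simp del: enc_lit.simps)
    next
      case 2
      then show ?thesis using A by (auto simp del: enc_lit.simps)
    next
      case (3 i t)
      define as where "as = list_decode t"
      have as: "length as = sig ! i" "set as \<subseteq> lset w" using 3 by (auto simp: as_def)
      from 3(4) consider "c = enc_lit (True, ARel i as)" | "c = enc_lit (False, ARel i as)"
        by (auto simp: as_def)
      then show ?thesis
      proof cases
        case 1
        then show ?thesis using as 3(1) c by (auto simp: A_def simp del: enc_lit.simps)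
      next
        case 2
        then have "enc_lit (True, ARel i as) \<notin> lset u" using rel as 3(1) c by blast
        then show ?thesis using as 3(1) 2 by (auto simp: A_def simp del: enc_lit.simps)
      qed
    qed
  qed
  moreover have "enc_lit l \<in> lset u" if "l \<in> diag sig A" for l
  proof (cases l rule: literal_cases)
    case (Eq a b)
    then have "a = b" "a \<in> lset w" using that A by auto
    then show ?thesis using eq unfolding Eq by blast
  next
    case (Neq a b)
    then have "a \<noteq> b" "a \<in> lset w" "b \<in> lset w" using that A by auto
    then show ?thesis using neq unfolding Neq by blast
  next
    case (Rel i as)
    then show ?thesis using that by (simp add: A_def del: enc_lit.simps)
  next
    case (NRel i as)
    then have as: "i < length sig" "length as = sig ! i" "set as \<subseteq> lset w"
      "enc_lit (True, ARel i as) \<notin> lset u"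
      using that by (auto simp: A_def simp del: enc_lit.simps)
    then show ?thesis using rel unfolding NRel by blast
  qed
  ultimately have "lset u = enc_lit ` diag sig A" by blast
  then show "codes_diag sig w u" unfolding codes_diag_def using A by blast
qed

lemma semidec_codes_diag [semi_intros]:
  assumes "recursive F" "recursive G"
  shows "semidec (\<lambda>x. codes_diag sig (F x) (G x))"
proof (rule semidec_comp2[OF _ assms])
  show "semidec (\<lambda>z. codes_diag sig (pfst z) (psnd z))"
    unfolding codes_diag_iff enc_lit.simps enc_atom.simps if_True if_False
  proof (intro semidec_conj)
    show "semidec (\<lambda>z. \<forall>i<length sig. \<forall>as. length as = sig ! i \<longrightarrow> set as \<subseteq> lset (pfst z) \<longrightarrow>
       prod_encode (1, prod_encode (1, prod_encode (i, list_encode as))) \<in> lset (psnd z) \<and>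
       prod_encode (0, prod_encode (1, prod_encode (i, list_encode as))) \<notin> lset (psnd z) \<or>
       prod_encode (0, prod_encode (1, prod_encode (i, list_encode as))) \<in> lset (psnd z) \<and>
       prod_encode (1, prod_encode (1, prod_encode (i, list_encode as))) \<notin> lset (psnd z))"
      by (intro semidec_all_bounded_const semidec_all_lists) (intro semi_intros rec_intros)+
  qed (intro semi_intros rec_intros)+
qed

lemma semidec_codes_FLO [semi_intros]:
  assumes "recursive F"
  shows "semidec (\<lambda>x. \<exists>B\<in>FLO. lset (F x) = enc_lit ` diag LO_sig B)"
proof -
  let ?le = "\<lambda>v a b. prod_encode (1, prod_encode (1, prod_encode (0,
      Suc (prod_encode (a, Suc (prod_encode (b, 0))))))) \<in> lset v"
  let ?nle = "\<lambda>v a b. prod_encode (1, prod_encode (1, prod_encode (0,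
      Suc (prod_encode (a, Suc (prod_encode (b, 0))))))) \<notin> lset v"
  \<comment> \<open>The implications in the order axioms are rewritten as disjunctions with
    \<open>?nle\<close>, since semidecidable predicates have no rule for implication.\<close>
  let ?lin = "\<lambda>v w. (\<forall>a\<in>lset w. ?le v a a) \<and>
    (\<forall>a\<in>lset w. \<forall>b\<in>lset w. ?nle v a b \<or> ?nle v b a \<or> a = b) \<and>
    (\<forall>a\<in>lset w. \<forall>b\<in>lset w. \<forall>c\<in>lset w. ?nle v a b \<or> ?nle v b c \<or> ?le v a c) \<and>
    (\<forall>a\<in>lset w. \<forall>b\<in>lset w. ?le v a b \<or> ?le v b a)"
  have lin: "?lin v w \<longleftrightarrow> B \<in> FLO"
    if B: "is_struct LO_sig B" "fst B = lset w" "lset v = enc_lit ` diag LO_sig B" for v w B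
  proof -
    have "?le v a b \<longleftrightarrow> snd B 0 [a, b]" for a b
      using enc_lit_mem_image[of "(True, ARel 0 [a, b])" "diag LO_sig B"] B(3) by simp
    then show ?thesis using B(1,2) unfolding FLO_def by simp blast
  qed
  have "(\<exists>B\<in>FLO. lset v = enc_lit ` diag LO_sig B) \<longleftrightarrow> (\<exists>w. codes_diag LO_sig w v \<and> ?lin v w)" for v
  proof
    assume "\<exists>B\<in>FLO. lset v = enc_lit ` diag LO_sig B"
    then obtain B where B: "B \<in> FLO" "lset v = enc_lit ` diag LO_sig B" by blast
    obtain us where us: "fst B = set us" using FLO_struct(2)[OF B(1)] by (metis finite_list)
    then have w: "fst B = lset (list_encode us)" by simp
    have "codes_diag LO_sig (list_encode us) v"
      unfolding codes_diag_def using B(2) FLO_struct(1)[OF B(1)] w by blast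
    moreover have "?lin v (list_encode us)"
      using lin[OF FLO_struct(1)[OF B(1)] w B(2)] B(1) ..
    ultimately show "\<exists>w. codes_diag LO_sig w v \<and> ?lin v w" by - (rule exI, rule conjI)
  next
    assume "\<exists>w. codes_diag LO_sig w v \<and> ?lin v w"
    then obtain w where w: "codes_diag LO_sig w v \<and> ?lin v w" ..
    from conjunct1[OF w] obtain B where B: "is_struct LO_sig B" "fst B = lset w"
      "lset v = enc_lit ` diag LO_sig B" unfolding codes_diag_def by blast
    have "B \<in> FLO" using lin[OF B] conjunct2[OF w] ..
    then show "\<exists>B\<in>FLO. lset v = enc_lit ` diag LO_sig B" using B(3) ..
  qed
  then show ?thesis
    by (simp only:) (intro semi_intros rec_intros recursive_comp[OF assms])
qed


subsection \<open>Embeddings and enumerations of pairs\<close>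

definition transf_codes :: "transf \<Rightarrow> nat set" where
  "transf_codes \<Phi> = {prod_encode (enc_lits \<alpha>, enc_lit \<phi>) | \<alpha> \<phi>. (\<alpha>, \<phi>) \<in> \<Phi>}"

text \<open>The search may run over all numbers \<open>a\<close>: membership in
  \<open>transf_codes\<close> already forces \<open>a\<close> to code a list of literals.\<close>

lemma mem_apply_transf_iff:
  assumes "lset u = enc_lit ` diag sig A"
  shows "l \<in> apply_transf \<Phi> sig A \<longleftrightarrow>
    (\<exists>a. prod_encode (a, enc_lit l) \<in> transf_codes \<Phi> \<and> lset a \<subseteq> lset u)"
proof -
  have "prod_encode (a, enc_lit l) \<in> transf_codes \<Phi> \<longleftrightarrow> (\<exists>\<alpha>. a = enc_lits \<alpha> \<and> (\<alpha>, l) \<in> \<Phi>)" for a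
    unfolding transf_codes_def mem_Collect_eq prod_encode_eq prod.inject inj_eq[OF inj_enc_lit]
    by blast
  moreover have "lset (enc_lits \<alpha>) \<subseteq> lset u \<longleftrightarrow> set \<alpha> \<subseteq> diag sig A" for \<alpha>
    by (simp add: assms inj_image_subset_iff[OF inj_enc_lit])
  ultimately show ?thesis unfolding apply_transf_def mem_Collect_eq by metis
qed

context
  fixes sig K \<Phi>
  assumes K: "is_class sig K" and emb: "computable_embedding sig K LO_sig FLO \<Phi>"
begin

lemma K_struct: "C \<in> K \<Longrightarrow> is_struct sig C"
  using K by (simp add: is_class_def)

lemma emb_image: "C \<in> K \<Longrightarrow> \<exists>B\<in>FLO. apply_transf \<Phi> sig C = diag LO_sig B"
  using emb by (auto simp: computable_embedding_def computable_transformation_def)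

lemma emb_iso_iff:
  "C \<in> K \<Longrightarrow> C' \<in> K \<Longrightarrow> B \<in> FLO \<Longrightarrow> B' \<in> FLO \<Longrightarrow> apply_transf \<Phi> sig C = diag LO_sig B \<Longrightarrow>
    apply_transf \<Phi> sig C' = diag LO_sig B' \<Longrightarrow> iso C C' \<longleftrightarrow> iso B B'"
  using emb unfolding computable_embedding_def by blast

lemma semidec_transf_codes: "semidec (\<lambda>x. x \<in> transf_codes \<Phi>)"
  using emb unfolding computable_embedding_def computable_transformation_def
    transf_codes_def[symmetric] ce_set_iff_semidec by blast

definition pairs :: "(struct \<times> struct) set" where
  "pairs = {(A, B). is_struct sig A \<and> finite (fst A) \<and> B \<in> FLO \<and>
     diag LO_sig B \<subseteq> apply_transf \<Phi> sig A}"

lemma ce_pairs: "ce_struct_pairs sig LO_sig pairs"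
proof -
  let ?P = "\<lambda>u v. (\<exists>w. codes_diag sig w u) \<and> (\<exists>B\<in>FLO. lset v = enc_lit ` diag LO_sig B) \<and>
    (\<forall>y\<in>lset v. \<exists>a. prod_encode (a, y) \<in> transf_codes \<Phi> \<and> lset a \<subseteq> lset u)"
  have "?P u v \<longleftrightarrow> (\<exists>xs ys A B. u = enc_lits xs \<and> v = enc_lits ys \<and> (A, B) \<in> pairs \<and>
      set xs = diag sig A \<and> set ys = diag LO_sig B)" for u v
  proof
    assume "?P u v"
    then have uv: "\<exists>w. codes_diag sig w u" "\<exists>B\<in>FLO. lset v = enc_lit ` diag LO_sig B"
      and P: "\<forall>y\<in>lset v. \<exists>a. prod_encode (a, y) \<in> transf_codes \<Phi> \<and> lset a \<subseteq> lset u"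
      by - (elim conjE, assumption)+
    obtain A B where AB: "is_struct sig A" "finite (fst A)" "lset u = enc_lit ` diag sig A"
      "B \<in> FLO" "lset v = enc_lit ` diag LO_sig B" using uv unfolding codes_diag_ex by metis
    have "diag LO_sig B \<subseteq> apply_transf \<Phi> sig A"
    proof
      fix l assume "l \<in> diag LO_sig B"
      then have "enc_lit l \<in> lset v" using AB(5) by simp
      then show "l \<in> apply_transf \<Phi> sig A" using P unfolding mem_apply_transf_iff[OF AB(3)] by blast
    qed
    then have "(A, B) \<in> pairs" using AB by (simp add: pairs_def)
    then show "\<exists>xs ys A B. u = enc_lits xs \<and> v = enc_lits ys \<and> (A, B) \<in> pairs \<and>
      set xs = diag sig A \<and> set ys = diag LO_sig B"
      using AB(3,5) unfolding lset_eq_image_iff by blast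
  next
    assume "\<exists>xs ys A B. u = enc_lits xs \<and> v = enc_lits ys \<and> (A, B) \<in> pairs \<and>
      set xs = diag sig A \<and> set ys = diag LO_sig B"
    then obtain A B where AB: "is_struct sig A" "finite (fst A)" "lset u = enc_lit ` diag sig A"
      "B \<in> FLO" "lset v = enc_lit ` diag LO_sig B" "diag LO_sig B \<subseteq> apply_transf \<Phi> sig A"
      unfolding pairs_def lset_eq_image_iff by blast
    have "\<exists>a. prod_encode (a, y) \<in> transf_codes \<Phi> \<and> lset a \<subseteq> lset u" if "y \<in> lset v" for y
    proof -
      obtain l where "y = enc_lit l" "l \<in> diag LO_sig B" using \<open>y \<in> lset v\<close> AB(5) by blast
      then show ?thesis using AB(6) mem_apply_transf_iff[OF AB(3), of l \<Phi>] by blast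
    qed
    then show "?P u v" unfolding codes_diag_ex using AB by blast
  qed
  moreover have "semidec (\<lambda>z. ?P (pfst z) (psnd z))"
    by (intro semi_intros rec_intros semidec_comp[OF semidec_transf_codes])
  ultimately have "semidec (\<lambda>z. \<exists>xs ys A B. pfst z = enc_lits xs \<and> psnd z = enc_lits ys \<and>
      (A, B) \<in> pairs \<and> set xs = diag sig A \<and> set ys = diag LO_sig B)" by simp
  moreover have "(\<exists>xs ys A B. pfst z = enc_lits xs \<and> psnd z = enc_lits ys \<and>
      (A, B) \<in> pairs \<and> set xs = diag sig A \<and> set ys = diag LO_sig B) \<longleftrightarrow>
    (\<exists>xs ys A B. z = prod_encode (enc_lits xs, enc_lits ys) \<and>
      (A, B) \<in> pairs \<and> set xs = diag sig A \<and> set ys = diag LO_sig B)" for z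
    by (metis encode_pfst_psnd pfst_encode psnd_encode)
  ultimately show ?thesis
    unfolding ce_struct_pairs_def ce_set_iff_semidec mem_Collect_eq by (simp only:)
qed

lemma pairs_substructure:
  assumes "C \<in> K" "(A, B) \<in> pairs" "substructure A C" "B0 \<in> FLO"
    "apply_transf \<Phi> sig C = diag LO_sig B0"
  shows "substructure B B0"
proof -
  have AB: "is_struct sig A" "B \<in> FLO" "diag LO_sig B \<subseteq> apply_transf \<Phi> sig A"
    using assms(2) by (auto simp: pairs_def)
  have "diag LO_sig B \<subseteq> diag LO_sig B0"
    using AB(3) apply_transf_mono[of sig A C \<Phi>] diag_subset_iff[OF AB(1) K_struct[OF assms(1)]]
      assms(3,5) by blast
  then show ?thesis
    using diag_subset_iff[OF FLO_struct(1)[OF AB(2)] FLO_struct(1)[OF assms(4)]] by blast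
qed

lemma pairs_complete:
  assumes "C \<in> K" "B \<in> FLO" "apply_transf \<Phi> sig C = diag LO_sig B"
  shows "\<exists>A. (A, B) \<in> pairs \<and> substructure A C"
proof -
  have "finite (diag LO_sig B)" using finite_diag[OF FLO_struct[OF assms(2)]] .
  then obtain A where "is_struct sig A" "finite (fst A)" "substructure A C"
    "diag LO_sig B \<subseteq> apply_transf \<Phi> sig A"
    using finite_support_apply[OF K_struct[OF assms(1)] _ eq_refl[OF assms(3)[symmetric]]] by blast
  then show ?thesis using assms(2) unfolding pairs_def by blast
qed

text \<open>\<open>B0\<close> is the largest order attached to substructures of \<open>C\<close>,
  and it is itself attached by finite support. Antisymmetry of inclusion then gives equality and not
  only isomorphism, so the isomorphism condition transfers directly.\<close>

lemma sufficient_pairs_iff: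
  assumes "C \<in> K" "(A, B) \<in> pairs" "substructure A C" "B0 \<in> FLO"
    "apply_transf \<Phi> sig C = diag LO_sig B0"
  shows "sufficient pairs C (A, B) \<longleftrightarrow> B = B0"
proof
  assume "sufficient pairs C (A, B)"
  moreover obtain A0 where "(A0, B0) \<in> pairs" "substructure A0 C"
    using pairs_complete[OF assms(1,4,5)] by blast
  ultimately have "substructure B0 B" unfolding sufficient_def snd_conv by blast
  moreover have "B \<in> FLO" using assms(2) by (simp add: pairs_def)
  ultimately show "B = B0"
    using pairs_substructure[OF assms] assms(4) FLO_substructure_antisym by blast
next
  assume "B = B0"
  then show "sufficient pairs C (A, B)"
    using pairs_substructure[OF assms(1) _ _ assms(4,5)] unfolding sufficient_def snd_conv by blast
qed

lemma embedding_imp_pairs: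
  "\<exists>S. ce_struct_pairs sig LO_sig S \<and>
      (\<forall>A B. (A, B) \<in> S \<longrightarrow> is_struct sig A \<and> finite (fst A) \<and> B \<in> FLO) \<and>
      (\<forall>C \<in> K. \<exists>A B. (A, B) \<in> S \<and> substructure A C \<and> sufficient S C (A, B)) \<and>
      (\<forall>C C' A B A' B'. C \<in> K \<longrightarrow> C' \<in> K \<longrightarrow> (A, B) \<in> S \<longrightarrow> (A', B') \<in> S \<longrightarrow>
         substructure A C \<longrightarrow> substructure A' C' \<longrightarrow>
         sufficient S C (A, B) \<longrightarrow> sufficient S C' (A', B') \<longrightarrow>
         (iso C C' \<longleftrightarrow> iso B B'))"
proof (intro exI[of _ pairs] conjI)
  show "ce_struct_pairs sig LO_sig pairs" by (rule ce_pairs)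
  show "\<forall>A B. (A, B) \<in> pairs \<longrightarrow> is_struct sig A \<and> finite (fst A) \<and> B \<in> FLO"
    by (simp add: pairs_def)
  show "\<forall>C \<in> K. \<exists>A B. (A, B) \<in> pairs \<and> substructure A C \<and> sufficient pairs C (A, B)"
  proof
    fix C assume C: "C \<in> K"
    obtain B where B: "B \<in> FLO" "apply_transf \<Phi> sig C = diag LO_sig B" using emb_image[OF C] by blast
    obtain A where A: "(A, B) \<in> pairs" "substructure A C" using pairs_complete[OF C B] by blast
    have "sufficient pairs C (A, B)" using sufficient_pairs_iff[OF C A B] by simp
    then show "\<exists>A B. (A, B) \<in> pairs \<and> substructure A C \<and> sufficient pairs C (A, B)" using A by blast
  qed
  show "\<forall>C C' A B A' B'. C \<in> K \<longrightarrow> C' \<in> K \<longrightarrow> (A, B) \<in> pairs \<longrightarrow> (A', B') \<in> pairs \<longrightarrow>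
         substructure A C \<longrightarrow> substructure A' C' \<longrightarrow>
         sufficient pairs C (A, B) \<longrightarrow> sufficient pairs C' (A', B') \<longrightarrow> (iso C C' \<longleftrightarrow> iso B B')"
  proof (intro allI impI)
    fix C C' A B A' B'
    assume *: "C \<in> K" "C' \<in> K" "(A, B) \<in> pairs" "(A', B') \<in> pairs"
      "substructure A C" "substructure A' C'"
      "sufficient pairs C (A, B)" "sufficient pairs C' (A', B')"
    obtain D where D: "D \<in> FLO" "apply_transf \<Phi> sig C = diag LO_sig D"
      using emb_image[OF *(1)] by blast
    obtain D' where D': "D' \<in> FLO" "apply_transf \<Phi> sig C' = diag LO_sig D'"
      using emb_image[OF *(2)] by blast
    have "B = D" using sufficient_pairs_iff[OF *(1,3,5) D] *(7) by simp
    moreover have "B' = D'" using sufficient_pairs_iff[OF *(2,4,6) D'] *(8) by simp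
    ultimately show "iso C C' \<longleftrightarrow> iso B B'" using emb_iso_iff[OF *(1,2) D(1) D'(1) D(2) D'(2)] by simp
  qed
qed

end

section \<open>From enumerated pairs to an embedding\<close>

lemma pairs_imp_embedding:
  assumes K: "is_class sig K"
    and ce: "ce_struct_pairs sig LO_sig S"
    and S: "\<And>A B. (A, B) \<in> S \<Longrightarrow> is_struct sig A \<and> finite (fst A) \<and> B \<in> FLO"
    and ex: "\<And>C. C \<in> K \<Longrightarrow> \<exists>A B. (A, B) \<in> S \<and> substructure A C \<and> sufficient S C (A, B)"
    and iso: "\<And>C C' A B A' B'. C \<in> K \<Longrightarrow> C' \<in> K \<Longrightarrow> (A, B) \<in> S \<Longrightarrow> (A', B') \<in> S \<Longrightarrow>
         substructure A C \<Longrightarrow> substructure A' C' \<Longrightarrow>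
         sufficient S C (A, B) \<Longrightarrow> sufficient S C' (A', B') \<Longrightarrow> iso C C' \<longleftrightarrow> iso B B'"
  shows "comp_reducible sig K LO_sig FLO"
proof -
  define \<Phi> :: transf where
    "\<Phi> = {(\<alpha>, l) | \<alpha> l A B. (A, B) \<in> S \<and> set \<alpha> = diag sig A \<and> l \<in> diag LO_sig B}"
  have K_struct: "C \<in> K \<Longrightarrow> is_struct sig C" for C using K by (simp add: is_class_def)
  \<comment> \<open>Sufficiency makes \<open>B\<close> the largest of the orders contributed below
    \<open>C\<close>, so the union of their diagrams is again a diagram and cannot be
    inconsistent.\<close>
  have app: "apply_transf \<Phi> sig C = diag LO_sig B"
    if C: "C \<in> K" and AB: "(A, B) \<in> S" "substructure A C" "sufficient S C (A, B)" for C A B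
  proof
    show "apply_transf \<Phi> sig C \<subseteq> diag LO_sig B"
    proof
      fix l assume "l \<in> apply_transf \<Phi> sig C"
      then obtain A' B' where A': "(A', B') \<in> S" "l \<in> diag LO_sig B'" "diag sig A' \<subseteq> diag sig C"
        by (auto simp: apply_transf_def \<Phi>_def)
      then have "substructure A' C" using diag_subset_iff S K_struct[OF C] by blast
      then have "substructure B' B" using AB(3) A'(1) unfolding sufficient_def snd_conv by blast
      then have "diag LO_sig B' \<subseteq> diag LO_sig B"
        using diag_subset_iff S[OF A'(1)] S[OF AB(1)] FLO_struct(1) by blast
      then show "l \<in> diag LO_sig B" using A'(2) by blast
    qed
    show "diag LO_sig B \<subseteq> apply_transf \<Phi> sig C"
    proof
      fix l assume l: "l \<in> diag LO_sig B"
      obtain \<alpha> where \<alpha>: "set \<alpha> = diag sig A"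
        using finite_diag[of sig A] S[OF AB(1)] by (metis finite_list)
      have "diag sig A \<subseteq> diag sig C" using diag_subset_iff S[OF AB(1)] K_struct[OF C] AB(2) by blast
      then show "l \<in> apply_transf \<Phi> sig C"
        using \<alpha> l AB(1) unfolding apply_transf_def \<Phi>_def by blast
    qed
  qed
  define SC where "SC = {prod_encode (enc_lits xs, enc_lits ys) | xs ys A B.
      (A, B) \<in> S \<and> set xs = diag sig A \<and> set ys = diag LO_sig B}"
  have SC: "semidec (\<lambda>x. x \<in> SC)"
    using ce unfolding ce_struct_pairs_def SC_def[symmetric] ce_set_iff_semidec .
  \<comment> \<open>A pair of \<open>\<Phi>\<close> is recognised by searching for a listing
    \<open>v\<close> of the whole diagram of the attached order and finding the literal among its
    entries; such a listing exists because the order is finite.\<close>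
  have "z \<in> transf_codes \<Phi> \<longleftrightarrow> (\<exists>v. prod_encode (pfst z, v) \<in> SC \<and> psnd z \<in> lset v)" for z
  proof
    assume "z \<in> transf_codes \<Phi>"
    then obtain \<alpha> l A B where z: "z = prod_encode (enc_lits \<alpha>, enc_lit l)"
      "(A, B) \<in> S" "set \<alpha> = diag sig A" "l \<in> diag LO_sig B"
      by (auto simp: transf_codes_def \<Phi>_def)
    obtain ys where ys: "set ys = diag LO_sig B"
      using finite_diag[of LO_sig B] S[OF z(2)] FLO_struct by (metis finite_list)
    have "pfst z = enc_lits \<alpha>" using z(1) by simp
    then have "prod_encode (pfst z, enc_lits ys) \<in> SC"
      using z(2,3) ys unfolding SC_def by (simp only:) blast
    moreover have "psnd z \<in> lset (enc_lits ys)"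
      using z ys by (simp del: enc_lit.simps)
    ultimately show "\<exists>v. prod_encode (pfst z, v) \<in> SC \<and> psnd z \<in> lset v" by blast
  next
    assume "\<exists>v. prod_encode (pfst z, v) \<in> SC \<and> psnd z \<in> lset v"
    then obtain v where "prod_encode (pfst z, v) \<in> SC" "psnd z \<in> lset v" by blast
    then obtain xs ys A B where *: "pfst z = enc_lits xs" "v = enc_lits ys"
      "(A, B) \<in> S" "set xs = diag sig A" "set ys = diag LO_sig B" by (auto simp: SC_def)
    then obtain l where l: "l \<in> diag LO_sig B" "psnd z = enc_lit l"
      using \<open>psnd z \<in> lset v\<close> by auto
    have "z = prod_encode (enc_lits xs, enc_lit l)" using * l by (metis encode_pfst_psnd)
    moreover have "(xs, l) \<in> \<Phi>" using * l unfolding \<Phi>_def by blast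
    ultimately show "z \<in> transf_codes \<Phi>" unfolding transf_codes_def by blast
  qed
  moreover have "semidec (\<lambda>z. \<exists>v. prod_encode (pfst z, v) \<in> SC \<and> psnd z \<in> lset v)"
    by (intro semi_intros rec_intros semidec_comp[OF SC])
  ultimately have "ce_set (transf_codes \<Phi>)" unfolding ce_set_iff_semidec by simp
  moreover have "\<exists>M. is_struct sig M \<and> finite (fst M) \<and> set \<alpha> \<subseteq> diag sig M" if "(\<alpha>, l) \<in> \<Phi>" for \<alpha> l
    using that S unfolding \<Phi>_def by blast
  moreover have "\<exists>B\<in>FLO. apply_transf \<Phi> sig C = diag LO_sig B" if "C \<in> K" for C
    using ex[OF that] app[OF that] S by blast
  ultimately have "computable_transformation sig K LO_sig FLO \<Phi>"
    unfolding computable_transformation_def transf_codes_def by blast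
  moreover have "iso C C' \<longleftrightarrow> iso D D'" if D: "C \<in> K" "C' \<in> K" "D \<in> FLO" "D' \<in> FLO"
    "apply_transf \<Phi> sig C = diag LO_sig D" "apply_transf \<Phi> sig C' = diag LO_sig D'" for C C' D D'
  proof -
    obtain A B where AB: "(A, B) \<in> S" "substructure A C" "sufficient S C (A, B)" using ex D(1) by blast
    obtain A' B' where AB': "(A', B') \<in> S" "substructure A' C'" "sufficient S C' (A', B')"
      using ex D(2) by blast
    \<comment> \<open>Outputs are given only through their diagrams, but these determine the
      structures.\<close>
    have "D = B" using app[OF D(1) AB] D(5) diag_inject FLO_struct(1) S[OF AB(1)] D(3) by metis
    moreover have "D' = B'"
      using app[OF D(2) AB'] D(6) diag_inject FLO_struct(1) S[OF AB'(1)] D(4) by metis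
    ultimately show ?thesis using iso[OF D(1,2) AB(1) AB'(1) AB(2) AB'(2) AB(3) AB'(3)] by simp
  qed
  ultimately show ?thesis unfolding comp_reducible_def computable_embedding_def by blast
qed

subsection \<open>From embeddings to sequences of existential sentences\<close>

text \<open>The state pairs the remaining list with the accumulator. Once the list is exhausted the
  step is idle, so any number of iterations beyond the length gives the same result.\<close>

lemma fold_code_step:
  assumes "\<And>z. step z = (if pfst z = 0 then z
    else prod_encode (ctl (pfst z), f (cnth (pfst z) 0) (psnd z)))"
  shows "(step ^^ n) (prod_encode (list_encode xs, s)) =
    prod_encode (list_encode (drop n xs), fold f (take n xs) s)"
proof (induction n arbitrary: xs s)
  case (Suc n)
  show ?case
  proof (cases xs)
    case Nil
    have "step (prod_encode (0, s)) = prod_encode (0, s)" by (simp add: assms)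
    then have "(step ^^ m) (prod_encode (0, s)) = prod_encode (0, s)" for m
      by (induction m) auto
    from this[of "Suc n"] show ?thesis using Nil by (simp del: funpow.simps)
  next
    case (Cons a ys)
    have "step (prod_encode (list_encode xs, s)) = prod_encode (list_encode ys, f a s)"
      unfolding Cons assms using cnth_encode[of 0 "a # ys"] ctl_encode[of "a # ys"]
      by (simp del: cnth_encode ctl_encode)
    then show ?thesis using Suc.IH[of ys "f a s"] Cons
      by (simp add: funpow_Suc_right del: funpow.simps(2) list_encode.simps)
  qed
qed simp

text \<open>The code of the list serves as the number of iterations, as it bounds the
  length.\<close>

lemma recursive_fold:
  assumes "recursive (\<lambda>z. f (pfst z) (psnd z))" "recursive F" "recursive G"
  shows "recursive (\<lambda>x. fold f (list_decode (F x)) (G x))"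
proof -
  define step where "step z = (if pfst z = 0 then z
    else prod_encode (ctl (pfst z), f (cnth (pfst z) 0) (psnd z)))" for z
  have "recursive (\<lambda>z. f (cnth (pfst z) 0) (psnd z))"
    using recursive_comp[OF assms(1), of "\<lambda>z. prod_encode (cnth (pfst z) 0, psnd z)"]
    by (simp add: rec_intros)
  then have "recursive step" unfolding step_def by (intro rec_intros)
  then have "recursive (\<lambda>x. psnd ((step ^^ F x) (prod_encode (F x, G x))))"
    by (intro rec_intros recursive_funpow assms)
  moreover have "psnd ((step ^^ c) (prod_encode (c, s))) = fold f (list_decode c) s" for c s
    using fold_code_step[OF step_def, of c "list_decode c" s] length_le_list_encode[of "list_decode c"]
    by simp
  ultimately show ?thesis by simp
qed

section \<open>Conjunctions of diagrams and their codes\<close>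

fun atom_fm :: "atom \<Rightarrow> fm" where
  "atom_fm (AEq a b) = FEq a b"
| "atom_fm (ARel i as) = FRel i as"

fun lit_fm :: "literal \<Rightarrow> fm" where
  "lit_fm (b, a) = (if b then atom_fm a else FNot (atom_fm a))"

text \<open>The elements of the universe serve as indices of the bound variables.\<close>

definition conj_fm :: "literal list \<Rightarrow> fm" where
  "conj_fm xs = fold (\<lambda>l. FAnd (lit_fm l)) xs (FEq 0 0)"

lemma eval_conj_fm: "eval_fm I as (conj_fm xs) \<longleftrightarrow> (\<forall>l\<in>set xs. eval_fm I as (lit_fm l))"
proof -
  have "eval_fm I as (fold (\<lambda>l. FAnd (lit_fm l)) xs p) \<longleftrightarrow>
      (\<forall>l\<in>set xs. eval_fm I as (lit_fm l)) \<and> eval_fm I as p" for p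
    by (induction xs arbitrary: p) auto
  then show ?thesis by (simp add: conj_fm_def)
qed

text \<open>Positivity of \<open>k\<close> makes the initial conjunct \<open>FEq 0 0\<close> well
  formed.\<close>

lemma wf_conj_fm:
  assumes "is_struct sig A" "set xs \<subseteq> diag sig A" "fst A \<subseteq> {..<k}" "k > 0"
  shows "wf_fm sig k (conj_fm xs)"
proof -
  have lit: "wf_fm sig k (lit_fm l)" if "l \<in> diag sig A" for l
    using that assms(3) is_structD[OF assms(1)] by (cases l rule: literal_cases) fastforce+
  have "wf_fm sig k (fold (\<lambda>l. FAnd (lit_fm l)) xs p)" if "wf_fm sig k p" for p
    using assms(2) that by (induction xs arbitrary: p) (auto simp: lit)
  then show ?thesis using assms(4) by (simp add: conj_fm_def)
qed

text \<open>Atoms and atomic formulas have identical codes. Passing from a literal to its formula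
  thus means dropping the sign, or replacing the sign 0 by the tag 2 of \<open>FNot\<close>.\<close>

definition clit_fm :: "nat \<Rightarrow> nat" where
  "clit_fm c = (if pfst c = 0 then prod_encode (2, psnd c) else psnd c)"

definition cconj_fm :: "nat \<Rightarrow> nat" where
  "cconj_fm u = fold (\<lambda>c m. prod_encode (3, prod_encode (clit_fm c, m))) (list_decode u)
     (prod_encode (0, prod_encode (0, 0)))"

lemma recursive_cconj_fm [rec_intros]: "recursive F \<Longrightarrow> recursive (\<lambda>x. cconj_fm (F x))"
  unfolding cconj_fm_def clit_fm_def by (intro recursive_fold rec_intros)

lemma cconj_fm_enc_lits: "cconj_fm (enc_lits xs) = enc_fm (conj_fm xs)"
proof -
  have "enc_fm (lit_fm l) = clit_fm (enc_lit l)" for l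
    by (cases l rule: literal_cases) (auto simp: clit_fm_def)
  then have "fold (\<lambda>c m. prod_encode (3, prod_encode (clit_fm c, m))) (map enc_lit xs) (enc_fm p) =
      enc_fm (fold (\<lambda>l. FAnd (lit_fm l)) xs p)" for p
    by (induction xs arbitrary: p) (simp, metis (no_types, lifting) enc_fm.simps(4) fold_simps(2) list.simps(9))
  from this[of "FEq 0 0"] show ?thesis by (simp add: cconj_fm_def conj_fm_def)
qed

section \<open>Sentences counting the elements of the output\<close>

context
  fixes sig K \<Phi>
  assumes K: "is_class sig K" and emb: "computable_embedding sig K LO_sig FLO \<Phi>"
begin

text \<open>A literal \<open>AEq x x\<close> in the output says that \<open>x\<close> belongs to the
  order, so \<open>b\<close> exhibits \<open>n + 1\<close> elements of it. Variables whose index is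
  not in \<open>A\<close> are quantified idly, hence \<open>k\<close> is only a bound for the
  universe.\<close>

definition size_sentence :: "nat \<Rightarrow> ex_sentence set" where
  "size_sentence n = {(k, conj_fm xs) | k xs A. is_struct sig A \<and> finite (fst A) \<and>
     set xs = diag sig A \<and> fst A \<subseteq> {..<k} \<and>
     (\<exists>b. inj_on b {..<Suc n} \<and> (\<forall>i<Suc n. (True, AEq (b i) (b i)) \<in> apply_transf \<Phi> sig A))}"

lemma size_sentence_wf:
  assumes "s \<in> size_sentence n" shows "wf_ex sig s"
proof -
  obtain k xs A where *: "s = (k, conj_fm xs)" "is_struct sig A" "set xs = diag sig A" "fst A \<subseteq> {..<k}"
    using assms by (auto simp: size_sentence_def)
  then have "k > 0" by (auto simp: is_struct_def)
  then show ?thesis using wf_conj_fm[of sig A xs k] * by (simp add: wf_ex_def)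
qed

lemma computable_size_sentence: "computable_sigma1_seq sig size_sentence"
proof -
  \<comment> \<open>\<open>d\<close> codes the sequence \<open>b\<close>, and injectivity is stated
    pairwise within the range that matters.\<close>
  let ?P = "\<lambda>n k m. \<exists>u w d. codes_diag sig w u \<and> (\<forall>a\<in>lset w. a < k) \<and> m = cconj_fm u \<and>
    (\<forall>i<Suc n. \<forall>j<Suc n. i = j \<or> cnth d i \<noteq> cnth d j) \<and>
    (\<forall>i<Suc n. \<exists>a. prod_encode (a, prod_encode (1, prod_encode (0, prod_encode (cnth d i, cnth d i))))
       \<in> transf_codes \<Phi> \<and> lset a \<subseteq> lset u)"
  have P: "?P n k m \<longleftrightarrow> (\<exists>s. prod_encode (k, m) = enc_ex s \<and> s \<in> size_sentence n)" for n k m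
  proof
    assume "?P n k m"
    then obtain u w d where P: "codes_diag sig w u" "\<forall>a\<in>lset w. a < k" "m = cconj_fm u"
      "\<forall>i<Suc n. \<forall>j<Suc n. i = j \<or> cnth d i \<noteq> cnth d j"
      "\<forall>i<Suc n. \<exists>a. prod_encode (a, prod_encode (1, prod_encode (0, prod_encode (cnth d i, cnth d i))))
       \<in> transf_codes \<Phi> \<and> lset a \<subseteq> lset u" by (elim exE conjE)
    from P(1) obtain A where A: "is_struct sig A" "fst A = lset w" "lset u = enc_lit ` diag sig A"
      unfolding codes_diag_def by blast
    from A(3) obtain xs where xs: "u = enc_lits xs" "set xs = diag sig A"
      unfolding lset_eq_image_iff by blast
    have "inj_on (cnth d) {..<Suc n}" using P(4) by (auto simp: inj_on_def)
    moreover have "\<forall>i<Suc n. (True, AEq (cnth d i) (cnth d i)) \<in> apply_transf \<Phi> sig A"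
      using P(5) unfolding mem_apply_transf_iff[OF A(3)] by simp
    moreover have "fst A \<subseteq> {..<k}" using P(2) A(2) by auto
    moreover have finite_A: "finite (fst A)" using A(2) by simp
    ultimately have "(k, conj_fm xs) \<in> size_sentence n"
      unfolding size_sentence_def using A(1) finite_A xs(2) by blast
    moreover have "prod_encode (k, m) = enc_ex (k, conj_fm xs)"
      by (simp add: enc_ex_def P(3) xs(1) cconj_fm_enc_lits)
    ultimately show "\<exists>s. prod_encode (k, m) = enc_ex s \<and> s \<in> size_sentence n" by blast
  next
    assume "\<exists>s. prod_encode (k, m) = enc_ex s \<and> s \<in> size_sentence n"
    then obtain xs A b where *: "m = enc_fm (conj_fm xs)" "is_struct sig A" "finite (fst A)"
      "set xs = diag sig A" "fst A \<subseteq> {..<k}" "inj_on b {..<Suc n}"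
      "\<forall>i<Suc n. (True, AEq (b i) (b i)) \<in> apply_transf \<Phi> sig A"
      by (auto simp: size_sentence_def enc_ex_def)
    obtain us where us: "set us = fst A" using *(3) finite_list by blast
    have u: "lset (enc_lits xs) = enc_lit ` diag sig A" using *(4) by simp
    define d where "d = list_encode (map b [0..<Suc n])"
    have d: "cnth d i = b i" if "i < Suc n" for i
      using that unfolding d_def by (subst cnth_encode) (auto simp del: upt_Suc)
    have "codes_diag sig (list_encode us) (enc_lits xs)"
      unfolding codes_diag_def using *(2) us u by (intro exI[of _ A]) simp
    moreover have "\<forall>a\<in>lset (list_encode us). a < k" using us *(5) by auto
    moreover have "m = cconj_fm (enc_lits xs)" using *(1) by (simp add: cconj_fm_enc_lits)
    moreover have "\<forall>i<Suc n. \<forall>j<Suc n. i = j \<or> cnth d i \<noteq> cnth d j"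
      using *(6) d unfolding inj_on_def by (metis lessThan_iff)
    moreover have "\<forall>i<Suc n. \<exists>a. prod_encode (a, prod_encode (1, prod_encode (0,
        prod_encode (cnth d i, cnth d i)))) \<in> transf_codes \<Phi> \<and> lset a \<subseteq> lset (enc_lits xs)"
      using *(7) d unfolding mem_apply_transf_iff[OF u] by simp
    ultimately show "?P n k m" by - (rule exI, rule exI, rule exI, intro conjI)
  qed
  have "semidec (\<lambda>z. ?P (pfst z) (pfst (psnd z)) (psnd (psnd z)))"
    by (intro semi_intros rec_intros semidec_comp[OF semidec_transf_codes[OF K emb]])
  then have "semidec (\<lambda>z. \<exists>s. psnd z = enc_ex s \<and> s \<in> size_sentence (pfst z))"
    unfolding P by simp
  moreover have "(\<exists>s. psnd z = enc_ex s \<and> s \<in> size_sentence (pfst z)) \<longleftrightarrow>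
    z \<in> {prod_encode (n, enc_ex s) | n s. s \<in> size_sentence n}" for z
    unfolding mem_Collect_eq by (metis encode_pfst_psnd pfst_encode psnd_encode)
  ultimately show ?thesis
    unfolding computable_sigma1_seq_def ce_set_iff_semidec using size_sentence_wf by simp
qed

text \<open>The delicate direction is from satisfaction to size. The tuple realising the diagram of
  \<open>A0\<close> may consist of other elements than those of \<open>A0\<close>, while
  \<open>\<Phi>\<close> reads the actual elements. The output \<open>B'\<close> on the renamed copy
  may differ from \<open>B\<close>; closure of \<open>K\<close> under isomorphism and the
  isomorphism condition of the embedding carry the count back.\<close>

lemma sat_size_sentence_iff:
  assumes A: "A \<in> K" and B: "B \<in> FLO" "apply_transf \<Phi> sig A = diag LO_sig B"
  shows "sat_sigma1 A (size_sentence n) \<longleftrightarrow> n < card (fst B)"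
proof
  assume "n < card (fst B)"
  then obtain X where X: "X \<subseteq> fst B" "card X = Suc n" "finite X"
    by (metis Suc_leI obtain_subset_with_card_n)
  obtain b where "bij_betw b {0..<card X} X" using ex_bij_betw_nat_finite[OF X(3)] by blast
  then have b: "inj_on b {..<Suc n}" "b ` {..<Suc n} = X"
    using X(2) by (auto simp: bij_betw_def atLeast0LessThan)
  let ?Y = "(\<lambda>x. (True, AEq x x)) ` X"
  have "?Y \<subseteq> apply_transf \<Phi> sig A" using B(2) X(1) by auto
  then obtain A0 where A0: "is_struct sig A0" "finite (fst A0)" "substructure A0 A"
    "?Y \<subseteq> apply_transf \<Phi> sig A0"
    using finite_support_apply[OF K_struct[OF K emb A], of ?Y \<Phi>] X(3) by blast
  obtain xs where xs: "set xs = diag sig A0" using finite_diag[OF A0(1,2)] finite_list by blast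
  obtain a0 where a0: "a0 \<in> fst A0" using A0(1) by (auto simp: is_struct_def)
  define k where "k = Suc (Max (fst A0))"
  have k: "c < k" if "c \<in> fst A0" for c using that A0(2) by (simp add: k_def le_imp_less_Suc)
  have "\<forall>i<Suc n. (True, AEq (b i) (b i)) \<in> apply_transf \<Phi> sig A0" using A0(4) b(2) by blast
  moreover have "fst A0 \<subseteq> {..<k}" using k by auto
  ultimately have "(k, conj_fm xs) \<in> size_sentence n"
    unfolding size_sentence_def using A0(1,2) xs b(1) by blast
  moreover have "sat_ex A (k, conj_fm xs)"
  proof -
    \<comment> \<open>The tuple needs length \<open>k\<close> and entries in \<open>A\<close>;
      \<open>a0\<close> fills the places whose index is not an element of \<open>A0\<close>.\<close>
    define as where "as = map (\<lambda>c. if c \<in> fst A0 then c else a0) [0..<k]"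
    have as: "as ! c = c" if "c \<in> fst A0" for c using that k by (simp add: as_def)
    have sub: "fst A0 \<subseteq> fst A" "\<And>i as. set as \<subseteq> fst A0 \<Longrightarrow> snd A0 i as \<longleftrightarrow> snd A i as"
      using A0(3) by (auto simp: substructure_def)
    have map: "map ((!) as) cs = cs" if "set cs \<subseteq> fst A0" for cs
      using that as by (intro map_idI) auto
    have "eval_fm (snd A) as (lit_fm l)" if l: "l \<in> diag sig A0" for l
    proof (cases l rule: literal_cases)
      case (Rel i cs)
      then have "snd A0 i cs" using l by simp
      from this is_structD(3)[OF A0(1) this] show ?thesis using Rel sub(2) map by simp
    next
      case (NRel i cs)
      then show ?thesis using l sub(2)[of cs] map[of cs] by simp
    qed (use l as in auto)
    then have "eval_fm (snd A) as (conj_fm xs)" using xs by (simp add: eval_conj_fm)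
    moreover have "set as \<subseteq> fst A" using sub(1) a0 by (auto simp: as_def)
    ultimately show ?thesis unfolding sat_ex_def by (intro exI[of _ as]) (simp add: as_def)
  qed
  ultimately show "sat_sigma1 A (size_sentence n)" unfolding sat_sigma1_def by blast
next
  assume "sat_sigma1 A (size_sentence n)"
  then obtain k xs A0 b as where *: "is_struct sig A0" "finite (fst A0)" "set xs = diag sig A0"
    "fst A0 \<subseteq> {..<k}" "inj_on b {..<Suc n}"
    "\<forall>i<Suc n. (True, AEq (b i) (b i)) \<in> apply_transf \<Phi> sig A0"
    "length as = k" "set as \<subseteq> fst A" "eval_fm (snd A) as (conj_fm xs)"
    unfolding sat_sigma1_def sat_ex_def size_sentence_def by auto
  have lit: "eval_fm (snd A) as (lit_fm l)" if "l \<in> diag sig A0" for l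
    using *(3,9) that by (simp add: eval_conj_fm)
  let ?h = "(!) as"
  have h: "?h c \<in> fst A" if "c \<in> fst A0" for c using that *(4,7,8) by (auto intro!: subsetD[OF *(8)] nth_mem)
  \<comment> \<open>The diagram of \<open>A0\<close> contains an inequality for any two distinct
    elements, and the tuple satisfies it.\<close>
  have inj_h: "inj_on ?h (fst A0)"
  proof (rule inj_onI)
    fix c d assume "c \<in> fst A0" "d \<in> fst A0" "as ! c = as ! d"
    then show "c = d" using lit[of "(False, AEq c d)"] by auto
  qed
  text \<open>The isomorphic copy of \<open>A\<close> that contains \<open>A0\<close> as a substructure: elements outside the
    tuple are moved above \<open>k\<close>.\<close>
  define g where "g y = (if y \<in> ?h ` fst A0 then inv_into (fst A0) ?h y else y + k)" for y
  have gh: "g (?h c) = c" if "c \<in> fst A0" for c using that inj_h by (simp add: g_def)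
  \<comment> \<open>As \<open>A0\<close> lies below \<open>k\<close>, the two branches of
    \<open>g\<close> have disjoint ranges, so injectivity can be checked on each branch.\<close>
  have g_less: "g y < k \<longleftrightarrow> y \<in> ?h ` fst A0" for y
    using gh *(4) by (auto simp: g_def)
  have inj_g: "inj_on g (fst A)"
  proof (rule inj_onI)
    fix x y assume xy: "g x = g y"
    show "x = y"
    proof (cases "x \<in> ?h ` fst A0")
      case True
      then have "y \<in> ?h ` fst A0" using xy g_less by metis
      then show ?thesis using True xy gh by auto
    next
      case False
      then have "y \<notin> ?h ` fst A0" using xy g_less by metis
      then show ?thesis using False xy by (simp add: g_def)
    qed
  qed
  let ?A = "image_struct g A"
  have "substructure A0 ?A"
    unfolding substructure_def
  proof (intro conjI allI impI)
    show "fst A0 \<subseteq> fst ?A"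
    proof
      fix c assume "c \<in> fst A0"
      then have "c = g (?h c)" "?h c \<in> fst A" using gh h by simp_all
      then show "c \<in> fst ?A" by (auto simp: image_struct_def)
    qed
    fix i cs assume cs: "set cs \<subseteq> fst A0"
    have "snd A0 i cs \<longleftrightarrow> snd A i (map ?h cs)"
    \<comment> \<open>Outside the signature the diagram is silent, and both relations are false
      because the structures are well formed.\<close>
    proof (cases "i < length sig \<and> length cs = sig ! i")
      case True
      then show ?thesis using lit[of "(True, ARel i cs)"] lit[of "(False, ARel i cs)"] cs by auto
    next
      case False
      then show ?thesis
        using is_structD[OF *(1), of i cs] is_structD[OF K_struct[OF K emb A], of i "map ?h cs"] by auto
    qed
    also have "\<dots> \<longleftrightarrow> snd ?A i (map g (map ?h cs))"
      using cs h by (intro image_struct_rel[OF inj_g]) auto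
    also have "map g (map ?h cs) = cs" using cs gh by (auto simp: map_idI subset_eq)
    finally show "snd A0 i cs \<longleftrightarrow> snd ?A i cs" .
  qed
  moreover have iso: "iso A ?A" by (rule iso_image_struct[OF inj_g])
  moreover have A': "?A \<in> K"
    using K A iso is_struct_image[OF K_struct[OF K emb A]] unfolding is_class_def by blast
  ultimately have "diag sig A0 \<subseteq> diag sig ?A" using diag_subset_iff *(1) K_struct[OF K emb] by blast
  then have app: "apply_transf \<Phi> sig A0 \<subseteq> apply_transf \<Phi> sig ?A" by (rule apply_transf_mono)
  obtain B' where B': "B' \<in> FLO" "apply_transf \<Phi> sig ?A = diag LO_sig B'"
    using emb_image[OF K emb A'] by blast
  have "iso B B'" using emb_iso_iff[OF K emb A A' B(1) B'(1) B(2) B'(2)] iso by blast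
  then have "card (fst B) = card (fst B')" by (rule iso_card)
  moreover have sub: "b ` {..<Suc n} \<subseteq> fst B'"
  proof
    fix x assume "x \<in> b ` {..<Suc n}"
    then have "(True, AEq x x) \<in> diag LO_sig B'" using *(6) app B'(2) by auto
    then show "x \<in> fst B'" by simp
  qed
  then have "Suc n \<le> card (fst B')"
    using card_mono[OF FLO_struct(2)[OF B'(1)] sub] card_image[OF *(5)] by simp
  ultimately show "n < card (fst B)" by simp
qed

lemma embedding_imp_sentences:
  "\<exists>\<phi>. computable_sigma1_seq sig \<phi> \<and>
      (\<forall>A \<in> K. \<exists>n. sat_sigma1 A (\<phi> n) \<and> \<not> sat_sigma1 A (\<phi> (Suc n))) \<and>
      (\<forall>A \<in> K. \<forall>n. sat_sigma1 A (\<phi> (Suc n)) \<longrightarrow> sat_sigma1 A (\<phi> n)) \<and>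
      (\<forall>A \<in> K. \<forall>A' \<in> K. \<not> iso A A' \<longrightarrow> (\<exists>n. sat_sigma1 A (\<phi> n) \<noteq> sat_sigma1 A' (\<phi> n)))"
proof (intro exI[of _ size_sentence] conjI ballI allI impI)
  show "computable_sigma1_seq sig size_sentence" by (rule computable_size_sentence)
next
  fix A assume A: "A \<in> K"
  obtain B where B: "B \<in> FLO" "apply_transf \<Phi> sig A = diag LO_sig B" using emb_image[OF K emb A] by blast
  \<comment> \<open>An order is nonempty, so sentence 0 holds throughout \<open>K\<close>, and the
    last true index is one less than the size.\<close>
  have "card (fst B) > 0"
    using B(1) by (auto simp: FLO_def is_struct_def card_gt_0_iff)
  then show "\<exists>n. sat_sigma1 A (size_sentence n) \<and> \<not> sat_sigma1 A (size_sentence (Suc n))"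
    unfolding sat_size_sentence_iff[OF A B] by (intro exI[of _ "card (fst B) - 1"]) auto
  fix n assume "sat_sigma1 A (size_sentence (Suc n))"
  then show "sat_sigma1 A (size_sentence n)" unfolding sat_size_sentence_iff[OF A B] by simp
next
  fix A A' assume A: "A \<in> K" "A' \<in> K" "\<not> iso A A'"
  obtain B where B: "B \<in> FLO" "apply_transf \<Phi> sig A = diag LO_sig B"
    using emb_image[OF K emb A(1)] by blast
  obtain B' where B': "B' \<in> FLO" "apply_transf \<Phi> sig A' = diag LO_sig B'"
    using emb_image[OF K emb A(2)] by blast
  have "card (fst B) \<noteq> card (fst B')"
    using emb_iso_iff[OF K emb A(1,2) B(1) B'(1) B(2) B'(2)] A(3) FLO_iso_iff_card[OF B(1) B'(1)] by simp
  \<comment> \<open>The smaller of the two cardinalities is a separating index.\<close>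
  then show "\<exists>n. sat_sigma1 A (size_sentence n) \<noteq> sat_sigma1 A' (size_sentence n)"
    unfolding sat_size_sentence_iff[OF A(1) B] sat_size_sentence_iff[OF A(2) B']
    by (metis linorder_neqE_nat less_irrefl)
qed

end


subsection \<open>From sequences of existential sentences to embeddings\<close>

abbreviation truth_bit :: "bool \<Rightarrow> nat" where "truth_bit b \<equiv> (if b then 1 else 0)"

text \<open>Truth of a quantifier-free formula is certified by a finite set \<open>E\<close> of pairs (formula, truth
  value) each of which is justified by pairs in \<open>E\<close> for the immediate subformulas; \<open>u\<close> is the
  coded diagram and \<open>t\<close> the coded assignment.\<close>

definition justified :: "nat \<Rightarrow> nat \<Rightarrow> nat \<Rightarrow> nat \<Rightarrow> bool" where
  "justified u t E e \<longleftrightarrow> (\<exists>m b. e = prod_encode (m, b) \<and>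
    ((\<exists>i j. m = prod_encode (0, prod_encode (i, j)) \<and>
       (b = 1 \<and> cnth t i = cnth t j \<or> b = 0 \<and> cnth t i \<noteq> cnth t j)) \<or>
     (\<exists>r vs v n. m = prod_encode (1, prod_encode (r, vs)) \<and>
       length (list_decode vs) = n \<and> length (list_decode v) = n \<and>
       (\<forall>i<n. cnth v i = cnth t (cnth vs i)) \<and>
       (b = 1 \<and> prod_encode (1, prod_encode (1, prod_encode (r, v))) \<in> lset u \<or>
        b = 0 \<and> prod_encode (0, prod_encode (1, prod_encode (r, v))) \<in> lset u)) \<or>
     (\<exists>p. m = prod_encode (2, p) \<and>
       (b = 1 \<and> prod_encode (p, 0) \<in> lset E \<or> b = 0 \<and> prod_encode (p, 1) \<in> lset E)) \<or>
     (\<exists>p q. m = prod_encode (3, prod_encode (p, q)) \<and>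
       (b = 1 \<and> prod_encode (p, 1) \<in> lset E \<and> prod_encode (q, 1) \<in> lset E \<or>
        b = 0 \<and> (prod_encode (p, 0) \<in> lset E \<or> prod_encode (q, 0) \<in> lset E))) \<or>
     (\<exists>p q. m = prod_encode (4, prod_encode (p, q)) \<and>
       (b = 1 \<and> (prod_encode (p, 1) \<in> lset E \<or> prod_encode (q, 1) \<in> lset E) \<or>
        b = 0 \<and> prod_encode (p, 0) \<in> lset E \<and> prod_encode (q, 0) \<in> lset E))))"

definition certified :: "nat \<Rightarrow> nat \<Rightarrow> nat \<Rightarrow> bool" where
  "certified u t m \<longleftrightarrow>
    (\<exists>E. prod_encode (m, 1) \<in> lset E \<and> (\<forall>e\<in>lset E. justified u t E e))"

lemma semidec_certified [semi_intros]:
  assumes "recursive F" "recursive G" "recursive H"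
  shows "semidec (\<lambda>x. certified (F x) (G x) (H x))"
proof (rule semidec_comp3[OF _ assms])
  show "semidec (\<lambda>z. certified (pfst z) (pfst (psnd z)) (psnd (psnd z)))"
    unfolding certified_def justified_def by (intro semi_intros rec_intros)
qed

lemma justified_simps:
  "justified u t E (prod_encode (enc_fm (FEq i j), b)) \<longleftrightarrow>
     b = 1 \<and> cnth t i = cnth t j \<or> b = 0 \<and> cnth t i \<noteq> cnth t j"
  "justified u t E (prod_encode (enc_fm (FNot p), b)) \<longleftrightarrow>
     b = 1 \<and> prod_encode (enc_fm p, 0) \<in> lset E \<or> b = 0 \<and> prod_encode (enc_fm p, 1) \<in> lset E"
  "justified u t E (prod_encode (enc_fm (FAnd p q), b)) \<longleftrightarrow>
     b = 1 \<and> prod_encode (enc_fm p, 1) \<in> lset E \<and> prod_encode (enc_fm q, 1) \<in> lset E \<or>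
     b = 0 \<and> (prod_encode (enc_fm p, 0) \<in> lset E \<or> prod_encode (enc_fm q, 0) \<in> lset E)"
  "justified u t E (prod_encode (enc_fm (FOr p q), b)) \<longleftrightarrow>
     b = 1 \<and> (prod_encode (enc_fm p, 1) \<in> lset E \<or> prod_encode (enc_fm q, 1) \<in> lset E) \<or>
     b = 0 \<and> prod_encode (enc_fm p, 0) \<in> lset E \<and> prod_encode (enc_fm q, 0) \<in> lset E"
  unfolding justified_def by simp_all

text \<open>\<open>justified\<close> guesses the list \<open>v\<close> of argument values instead of
  computing it; length and entries determine it uniquely, so the guess can be eliminated.\<close>

lemma justified_FRel:
  assumes "t = list_encode as" "\<forall>v\<in>set vs. v < length as"
  shows "justified u t E (prod_encode (enc_fm (FRel r vs), b)) \<longleftrightarrow>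
     b = 1 \<and> enc_lit (True, ARel r (map ((!) as) vs)) \<in> lset u \<or>
     b = 0 \<and> enc_lit (False, ARel r (map ((!) as) vs)) \<in> lset u"
proof -
  have *: "length (list_decode v) = length vs \<and>
      (\<forall>i<length vs. cnth v i = cnth t (cnth (list_encode vs) i)) \<longleftrightarrow>
      v = list_encode (map ((!) as) vs)" (is "?L v \<longleftrightarrow> _") for v
  proof
    assume L: "?L v"
    have "list_decode v = map ((!) as) vs"
    proof (rule nth_equalityI)
      show "length (list_decode v) = length (map ((!) as) vs)" using L by simp
      fix i assume "i < length (list_decode v)"
      then show "list_decode v ! i = map ((!) as) vs ! i"
        using L assms by (simp add: cnth_decode[symmetric])
    qed
    then show "v = list_encode (map ((!) as) vs)" by (metis list_decode_inverse)
  qed (use assms in simp)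
  have "justified u t E (prod_encode (enc_fm (FRel r vs), b)) \<longleftrightarrow>
    (\<exists>v. (length (list_decode v) = length vs \<and>
      (\<forall>i<length vs. cnth v i = cnth t (cnth (list_encode vs) i))) \<and>
     (b = 1 \<and> prod_encode (1, prod_encode (1, prod_encode (r, v))) \<in> lset u \<or>
      b = 0 \<and> prod_encode (0, prod_encode (1, prod_encode (r, v))) \<in> lset u))"
    unfolding justified_def by (simp add: conj_assoc)
  then show ?thesis unfolding * by simp
qed

text \<open>Supplies the entries of the canonical certificate, hence a list and closed under
  immediate subformulas.\<close>

fun subfms :: "fm \<Rightarrow> fm list" where
  "subfms (FEq i j) = [FEq i j]"
| "subfms (FRel r vs) = [FRel r vs]"
| "subfms (FNot p) = FNot p # subfms p"
| "subfms (FAnd p q) = FAnd p q # subfms p @ subfms q"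
| "subfms (FOr p q) = FOr p q # subfms p @ subfms q"

lemma subfms_refl [simp]: "p \<in> set (subfms p)"
  by (cases p) auto

lemma subfms_closed:
  "FNot q \<in> set (subfms p) \<Longrightarrow> q \<in> set (subfms p)"
  "FAnd q q' \<in> set (subfms p) \<Longrightarrow> q \<in> set (subfms p) \<and> q' \<in> set (subfms p)"
  "FOr q q' \<in> set (subfms p) \<Longrightarrow> q \<in> set (subfms p) \<and> q' \<in> set (subfms p)"
  by (induction p) auto

lemma wf_subfms: "q \<in> set (subfms p) \<Longrightarrow> wf_fm sig k p \<Longrightarrow> wf_fm sig k q"
  by (induction p) auto

text \<open>Soundness is by induction on the formula: a justification refers only to immediate
  subformulas, so entries of \<open>E\<close> cannot support each other in a circle. For
  completeness \<open>E\<close> lists all subformulas with their actual truth values.\<close>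

lemma certified_iff:
  assumes A: "is_struct sig A" "lset u = enc_lit ` diag sig A"
    and as: "set as \<subseteq> fst A" "wf_fm sig (length as) p"
  shows "certified u (list_encode as) (enc_fm p) \<longleftrightarrow> eval_fm (snd A) as p"
proof -
  let ?t = "list_encode as"
  \<comment> \<open>A diagram has exactly one sign of each relational atom over the universe, so
    only the actual truth value is justified.\<close>
  have rel: "justified u ?t E (prod_encode (enc_fm (FRel r vs), b)) \<longleftrightarrow>
      b = truth_bit (eval_fm (snd A) as (FRel r vs))" if "wf_fm sig (length as) (FRel r vs)" for E r vs b
  proof -
    have "set (map ((!) as) vs) \<subseteq> fst A" using as(1) that by (auto intro!: subsetD[OF as(1)] nth_mem)
    then show ?thesis using that by (simp add: justified_FRel A(2) del: enc_fm.simps enc_lit.simps)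
  qed
  show ?thesis
  proof
    assume "certified u ?t (enc_fm p)"
    then obtain E where E: "prod_encode (enc_fm p, 1) \<in> lset E"
      "\<And>e. e \<in> lset E \<Longrightarrow> justified u ?t E e" unfolding certified_def by blast
    have "b = truth_bit (eval_fm (snd A) as q)"
      if "prod_encode (enc_fm q, b) \<in> lset E" "wf_fm sig (length as) q" for q b
      using that
    proof (induction q arbitrary: b)
      case (FEq i j)
      from E(2)[OF FEq.prems(1)] FEq.prems(2) show ?case
        unfolding justified_simps by (auto split: if_splits)
    next
      case (FRel r vs)
      from E(2)[OF FRel.prems(1)] show ?case unfolding rel[OF FRel.prems(2)] .
    next
      case (FNot q)
      from E(2)[OF FNot.prems(1)] FNot.IH[of 0] FNot.IH[of 1] FNot.prems(2) show ?case
        unfolding justified_simps by (auto split: if_splits)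
    next
      case (FAnd q q')
      from E(2)[OF FAnd.prems(1)] FAnd.IH(1)[of 0] FAnd.IH(1)[of 1] FAnd.IH(2)[of 0] FAnd.IH(2)[of 1]
        FAnd.prems(2) show ?case
        unfolding justified_simps by (auto split: if_splits)
    next
      case (FOr q q')
      from E(2)[OF FOr.prems(1)] FOr.IH(1)[of 0] FOr.IH(1)[of 1] FOr.IH(2)[of 0] FOr.IH(2)[of 1]
        FOr.prems(2) show ?case
        unfolding justified_simps by (auto split: if_splits)
    qed
    from this[OF E(1) as(2)] show "eval_fm (snd A) as p" by (simp split: if_splits)
  next
    assume p: "eval_fm (snd A) as p"
    define f where "f q = prod_encode (enc_fm q, truth_bit (eval_fm (snd A) as q))" for q
    define E where "E = list_encode (map f (subfms p))"
    have E: "lset E = f ` set (subfms p)" by (simp add: E_def)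
    have mem: "prod_encode (enc_fm q, b) \<in> lset E"
      if "q \<in> set (subfms p)" "b = truth_bit (eval_fm (snd A) as q)" for q b
      unfolding E using that by (auto simp: f_def)
    have "justified u ?t E (f q)" if q: "q \<in> set (subfms p)" for q
    proof -
      have wf: "wf_fm sig (length as) q" by (rule wf_subfms[OF q as(2)])
      show ?thesis
      proof (cases q)
        case (FEq i j)
        then show ?thesis using wf by (auto simp: f_def justified_simps simp del: enc_fm.simps)
      next
        case (FRel r vs)
        then show ?thesis using rel wf unfolding f_def FRel by blast
      next
        case (FNot q1)
        then have "q1 \<in> set (subfms p)" using q subfms_closed by blast
        from mem[OF this] show ?thesis unfolding f_def FNot justified_simps
          by (cases "eval_fm (snd A) as q1") simp_all
      next
        case (FAnd q1 q2)
        then have "q1 \<in> set (subfms p)" "q2 \<in> set (subfms p)" using q subfms_closed by blast+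
        from mem[OF this(1)] mem[OF this(2)] show ?thesis unfolding f_def FAnd justified_simps
          by (cases "eval_fm (snd A) as q1"; cases "eval_fm (snd A) as q2") simp_all
      next
        case (FOr q1 q2)
        then have "q1 \<in> set (subfms p)" "q2 \<in> set (subfms p)" using q subfms_closed by blast+
        from mem[OF this(1)] mem[OF this(2)] show ?thesis unfolding f_def FOr justified_simps
          by (cases "eval_fm (snd A) as q1"; cases "eval_fm (snd A) as q2") simp_all
      qed
    qed
    then have "\<forall>e\<in>lset E. justified u ?t E e" unfolding E by blast
    moreover have "prod_encode (enc_fm p, 1) \<in> lset E" using mem[of p 1] p by simp
    ultimately show "certified u ?t (enc_fm p)" unfolding certified_def by blast
  qed
qed

text \<open>Reflexive equality literals force the witnesses into \<open>A0\<close>, where the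
  quantifier-free matrix has the same value.\<close>

lemma finite_support_sat_ex:
  assumes A: "is_struct sig A" and s: "wf_ex sig s" "sat_ex A s"
  obtains A0 where "is_struct sig A0" "finite (fst A0)" "substructure A0 A" "sat_ex A0 s"
proof -
  obtain as where as: "length as = fst s" "set as \<subseteq> fst A" "eval_fm (snd A) as (snd s)"
    using s(2) by (auto simp: sat_ex_def)
  let ?X = "(\<lambda>a. (True, AEq a a)) ` set as"
  have "?X \<subseteq> diag sig A" using as(2) by auto
  then obtain A0 where A0: "is_struct sig A0" "finite (fst A0)" "substructure A0 A" "?X \<subseteq> diag sig A0"
    using finite_support_diag[OF A, of ?X] by blast
  have as0: "set as \<subseteq> fst A0" using A0(4) by auto
  have "eval_fm (snd A) (map id as) (snd s) \<longleftrightarrow> eval_fm (snd A0) as (snd s)"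
    using A0(3) as0 s(1) as(1)
    by (intro eval_fm_map[where sig = sig]) (auto simp: substructure_def wf_ex_def)
  then have "sat_ex A0 s" unfolding sat_ex_def using as as0 by auto
  then show ?thesis using that A0 by blast
qed

text \<open>An explicit list of the literals, arithmetical in \<open>n\<close>, from which the
  diagrams are enumerated uniformly in \<open>n\<close>.\<close>

lemma diag_std_order_iff:
  "l \<in> diag LO_sig (std_order (Suc n)) \<longleftrightarrow> (\<exists>a b. a \<le> n \<and> b \<le> n \<and>
     (l = (True, AEq a a) \<or> a \<noteq> b \<and> l = (False, AEq a b) \<or>
      a \<le> b \<and> l = (True, ARel 0 [a, b]) \<or> b < a \<and> l = (False, ARel 0 [a, b])))"
proof -
  have two: "length as = 2 \<longleftrightarrow> (\<exists>a b. as = [a, b])" for as :: "nat list"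
    by (auto simp: numeral_2_eq_2 length_Suc_conv)
  show ?thesis
    by (cases l rule: literal_cases)
       (auto simp: std_order_def LO_sig_def two less_Suc_eq_le not_le)
qed

text \<open>The standard orders form a chain under inclusion, so the contributions of several true
  sentences are compatible and the last one absorbs the others.\<close>

lemma diag_std_order_mono:
  assumes "m \<le> n"
  shows "diag LO_sig (std_order (Suc m)) \<subseteq> diag LO_sig (std_order (Suc n))"
proof -
  have "substructure (std_order (Suc m)) (std_order (Suc n))"
    using assms by (auto simp: substructure_def std_order_def)
  then show ?thesis
    using diag_subset_iff[OF FLO_struct(1) FLO_struct(1)] std_order_FLO by blast
qed

lemma card_std_order [simp]: "card (fst (std_order n)) = n"
  by (simp add: std_order_def)

lemma sentences_imp_embedding:
  assumes K: "is_class sig K"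
    and seq: "computable_sigma1_seq sig \<phi>"
    and ex: "\<And>A. A \<in> K \<Longrightarrow> \<exists>n. sat_sigma1 A (\<phi> n) \<and> \<not> sat_sigma1 A (\<phi> (Suc n))"
    and dec: "\<And>A n. A \<in> K \<Longrightarrow> sat_sigma1 A (\<phi> (Suc n)) \<Longrightarrow> sat_sigma1 A (\<phi> n)"
    and sep: "\<And>A A'. A \<in> K \<Longrightarrow> A' \<in> K \<Longrightarrow> \<not> iso A A' \<Longrightarrow>
        \<exists>n. sat_sigma1 A (\<phi> n) \<noteq> sat_sigma1 A' (\<phi> n)"
  shows "comp_reducible sig K LO_sig FLO"
proof -
  \<comment> \<open>Sentence 0 must already produce one element, hence \<open>Suc n\<close>. Truth
    of a disjunct is required in the finite \<open>M\<close> itself, so it can be confirmed from the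
    listed diagram.\<close>
  define \<Phi> :: transf where "\<Phi> = {(\<alpha>, l) | \<alpha> l M n s. is_struct sig M \<and> finite (fst M) \<and>
    set \<alpha> = diag sig M \<and> s \<in> \<phi> n \<and> sat_ex M s \<and> l \<in> diag LO_sig (std_order (Suc n))}"
  have K_struct: "A \<in> K \<Longrightarrow> is_struct sig A" for A using K by (simp add: is_class_def)
  have wf: "s \<in> \<phi> n \<Longrightarrow> wf_ex sig s" for s n using seq by (simp add: computable_sigma1_seq_def)
  \<comment> \<open>The true indices are closed downwards and contain \<open>N\<close> but not its
    successor, so they form an initial segment ending at \<open>N\<close>.\<close>
  have "\<exists>N. \<forall>n. sat_sigma1 A (\<phi> n) \<longleftrightarrow> n \<le> N" if A: "A \<in> K" for A
  proof -
    obtain N where N: "sat_sigma1 A (\<phi> N)" "\<not> sat_sigma1 A (\<phi> (Suc N))" using ex[OF A] by blast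
    have down: "sat_sigma1 A (\<phi> m)" if "m \<le> n" "sat_sigma1 A (\<phi> n)" for m n
      using that by (induction rule: dec_induct) (auto dest: dec[OF A])
    then have "sat_sigma1 A (\<phi> n) \<longleftrightarrow> n \<le> N" for n using N by (metis not_less_eq_eq)
    then show ?thesis by blast
  qed
  then obtain N where N: "\<And>A n. A \<in> K \<Longrightarrow> sat_sigma1 A (\<phi> n) \<longleftrightarrow> n \<le> N A" by metis
  have app: "apply_transf \<Phi> sig A = diag LO_sig (std_order (Suc (N A)))" if A: "A \<in> K" for A
  proof
    show "apply_transf \<Phi> sig A \<subseteq> diag LO_sig (std_order (Suc (N A)))"
    proof
      fix l assume "l \<in> apply_transf \<Phi> sig A"
      then obtain M n s where M: "is_struct sig M" "diag sig M \<subseteq> diag sig A" "s \<in> \<phi> n" "sat_ex M s"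
        "l \<in> diag LO_sig (std_order (Suc n))"
        unfolding apply_transf_def \<Phi>_def by auto
      have "substructure M A" using diag_subset_iff[OF M(1) K_struct[OF A]] M(2) by simp
      then have "sat_ex A s" using sat_ex_mono wf M(3,4) by blast
      then have "n \<le> N A" using N[OF A] M(3) unfolding sat_sigma1_def by blast
      then show "l \<in> diag LO_sig (std_order (Suc (N A)))" using M(5) diag_std_order_mono by blast
    qed
    show "diag LO_sig (std_order (Suc (N A))) \<subseteq> apply_transf \<Phi> sig A"
    proof
      fix l assume l: "l \<in> diag LO_sig (std_order (Suc (N A)))"
      obtain s where s: "s \<in> \<phi> (N A)" "sat_ex A s" using N[OF A, of "N A"] by (auto simp: sat_sigma1_def)
      obtain M where M: "is_struct sig M" "finite (fst M)" "substructure M A" "sat_ex M s"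
        using finite_support_sat_ex[OF K_struct[OF A] wf[OF s(1)] s(2)] by blast
      obtain \<alpha> where \<alpha>: "set \<alpha> = diag sig M" using finite_diag[OF M(1,2)] finite_list by blast
      have "(\<alpha>, l) \<in> \<Phi>" unfolding \<Phi>_def using M \<alpha> s l by blast
      moreover have "set \<alpha> \<subseteq> diag sig A"
        using \<alpha> diag_subset_iff[OF M(1) K_struct[OF A]] M(3) by simp
      ultimately show "l \<in> apply_transf \<Phi> sig A" unfolding apply_transf_def by blast
    qed
  qed
  define SC where "SC = {prod_encode (n, enc_ex s) | n s. s \<in> \<phi> n}"
  have SC: "semidec (\<lambda>x. x \<in> SC)"
    using seq unfolding computable_sigma1_seq_def SC_def[symmetric] ce_set_iff_semidec by blast
  let ?std = "\<lambda>n c. \<exists>a b. a \<le> n \<and> b \<le> n \<and>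
     (c = prod_encode (1, prod_encode (0, prod_encode (a, a))) \<or>
      a \<noteq> b \<and> c = prod_encode (0, prod_encode (0, prod_encode (a, b))) \<or>
      a \<le> b \<and> c = prod_encode (1, prod_encode (1, prod_encode (0,
        Suc (prod_encode (a, Suc (prod_encode (b, 0))))))) \<or>
      b < a \<and> c = prod_encode (0, prod_encode (1, prod_encode (0,
        Suc (prod_encode (a, Suc (prod_encode (b, 0))))))))"
  have std: "?std n c \<longleftrightarrow> (\<exists>l \<in> diag LO_sig (std_order (Suc n)). c = enc_lit l)" for n c
  proof
    assume "?std n c"
    then obtain a b where ab: "a \<le> n" "b \<le> n"
      "c = enc_lit (True, AEq a a) \<or> a \<noteq> b \<and> c = enc_lit (False, AEq a b) \<or>
       a \<le> b \<and> c = enc_lit (True, ARel 0 [a, b]) \<or> b < a \<and> c = enc_lit (False, ARel 0 [a, b])"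
      by (simp only: enc_lit.simps enc_atom.simps list_encode.simps if_True if_False) blast
    then show "\<exists>l \<in> diag LO_sig (std_order (Suc n)). c = enc_lit l"
      unfolding Bex_def diag_std_order_iff by blast
  next
    assume "\<exists>l \<in> diag LO_sig (std_order (Suc n)). c = enc_lit l"
    then obtain a b where ab: "a \<le> n" "b \<le> n"
      "c = enc_lit (True, AEq a a) \<or> a \<noteq> b \<and> c = enc_lit (False, AEq a b) \<or>
       a \<le> b \<and> c = enc_lit (True, ARel 0 [a, b]) \<or> b < a \<and> c = enc_lit (False, ARel 0 [a, b])"
      unfolding Bex_def diag_std_order_iff by blast
    then show "?std n c"
      by (simp only: enc_lit.simps enc_atom.simps list_encode.simps if_True if_False) blast
  qed
  \<comment> \<open>\<open>t\<close> guesses witnesses in the universe listed by \<open>w\<close>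
    for the existential sentence coded by \<open>k\<close> and \<open>m\<close>;
    \<open>certified\<close> checks its matrix.\<close>
  let ?P = "\<lambda>u c. \<exists>w n k m t. codes_diag sig w u \<and> prod_encode (n, prod_encode (k, m)) \<in> SC \<and>
    length (list_decode t) = k \<and> lset t \<subseteq> lset w \<and> certified u t m \<and> ?std n c"
  have P: "prod_encode (u, c) \<in> transf_codes \<Phi> \<longleftrightarrow> ?P u c" for u c
  proof
    assume "prod_encode (u, c) \<in> transf_codes \<Phi>"
    then obtain \<alpha> l M n s where *: "u = enc_lits \<alpha>" "c = enc_lit l" "is_struct sig M" "finite (fst M)"
      "set \<alpha> = diag sig M" "s \<in> \<phi> n" "sat_ex M s" "l \<in> diag LO_sig (std_order (Suc n))"
      unfolding transf_codes_def \<Phi>_def by auto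
    have u: "lset u = enc_lit ` diag sig M" using * by simp
    obtain us where us: "fst M = lset (list_encode us)" using finite_list[OF *(4)] by auto
    obtain as where as: "length as = fst s" "set as \<subseteq> fst M" "eval_fm (snd M) as (snd s)"
      using *(7) by (auto simp: sat_ex_def)
    have "codes_diag sig (list_encode us) u" unfolding codes_diag_def using *(3) us u by blast
    moreover have "prod_encode (n, prod_encode (fst s, enc_fm (snd s))) \<in> SC"
      using *(6) unfolding SC_def enc_ex_def by blast
    moreover have "length (list_decode (list_encode as)) = fst s" using as(1) by simp
    moreover have "lset (list_encode as) \<subseteq> lset (list_encode us)" using as(2) us by simp
    moreover have "certified u (list_encode as) (enc_fm (snd s))"
      using certified_iff[OF *(3) u as(2)] wf[OF *(6)] as(1,3) by (simp add: wf_ex_def)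
    moreover have "?std n c" unfolding std using *(2,8) by blast
    ultimately show "?P u c" by - (rule exI, rule exI, rule exI, rule exI, rule exI, intro conjI)
  next
    assume "?P u c"
    then obtain w n k m t where *: "codes_diag sig w u" "prod_encode (n, prod_encode (k, m)) \<in> SC"
      "length (list_decode t) = k" "lset t \<subseteq> lset w" "certified u t m"
      "\<exists>l \<in> diag LO_sig (std_order (Suc n)). c = enc_lit l"
      unfolding std by blast
    from *(1) obtain M where M: "is_struct sig M" "fst M = lset w" "lset u = enc_lit ` diag sig M"
      unfolding codes_diag_def by blast
    from M(3) obtain \<alpha> where \<alpha>: "u = enc_lits \<alpha>" "set \<alpha> = diag sig M"
      unfolding lset_eq_image_iff by blast
    from *(2) obtain s where s: "s \<in> \<phi> n" "k = fst s" "m = enc_fm (snd s)"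
      by (auto simp: SC_def enc_ex_def)
    from *(6) obtain l where l: "l \<in> diag LO_sig (std_order (Suc n))" "c = enc_lit l"
      by blast
    have "eval_fm (snd M) (list_decode t) (snd s)"
      using certified_iff[OF M(1,3), of "list_decode t" "snd s"] wf[OF s(1)] *(3,4,5) s M(2)
      by (simp add: wf_ex_def)
    then have "sat_ex M s" unfolding sat_ex_def using *(3,4) s(2) M(2) by blast
    moreover have "finite (fst M)" using M(2) by simp
    ultimately have "(\<alpha>, l) \<in> \<Phi>" unfolding \<Phi>_def using M(1) \<alpha>(2) s(1) l(1) by blast
    then show "prod_encode (u, c) \<in> transf_codes \<Phi>"
      unfolding transf_codes_def \<alpha>(1) l(2) by blast
  qed
  have "semidec (\<lambda>z. ?P (pfst z) (psnd z))"
    by (intro semi_intros rec_intros semidec_comp[OF SC])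
  then have "semidec (\<lambda>z. z \<in> transf_codes \<Phi>)" unfolding P[symmetric] by simp
  then have "ce_set (transf_codes \<Phi>)" unfolding ce_set_iff_semidec .
  moreover have "\<exists>M. is_struct sig M \<and> finite (fst M) \<and> set \<alpha> \<subseteq> diag sig M" if "(\<alpha>, l) \<in> \<Phi>" for \<alpha> l
    using that unfolding \<Phi>_def by blast
  moreover have "\<exists>B\<in>FLO. apply_transf \<Phi> sig A = diag LO_sig B" if "A \<in> K" for A
    using app[OF that] std_order_FLO by blast
  ultimately have "computable_transformation sig K LO_sig FLO \<Phi>"
    unfolding computable_transformation_def transf_codes_def by blast
  moreover have "iso A A' \<longleftrightarrow> iso B B'" if *: "A \<in> K" "A' \<in> K" "B \<in> FLO" "B' \<in> FLO"
    "apply_transf \<Phi> sig A = diag LO_sig B" "apply_transf \<Phi> sig A' = diag LO_sig B'" for A A' B B'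
  proof -
    have "B = std_order (Suc (N A))" "B' = std_order (Suc (N A'))"
      using app * diag_inject FLO_struct(1) std_order_FLO by (metis zero_less_Suc)+
    then have "iso B B' \<longleftrightarrow> N A = N A'" using FLO_iso_iff_card[OF *(3,4)] by simp
    \<comment> \<open>Separation yields one direction only; the other rests on the invariance of
      existential sentences under isomorphism.\<close>
    moreover have "iso A A' \<longleftrightarrow> N A = N A'"
    proof
      assume "iso A A'"
      then have "sat_sigma1 A (\<phi> n) \<longleftrightarrow> sat_sigma1 A' (\<phi> n)" for n
        unfolding sat_sigma1_def using sat_ex_iso iso_sym wf by metis
      then have "n \<le> N A \<longleftrightarrow> n \<le> N A'" for n using N *(1,2) by simp
      then show "N A = N A'" by (metis le_antisym order_refl)
    next
      assume "N A = N A'"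
      then show "iso A A'" using sep[OF *(1,2)] N[OF *(1)] N[OF *(2)] by auto
    qed
    ultimately show ?thesis by simp
  qed
  ultimately show ?thesis unfolding comp_reducible_def computable_embedding_def by blast
qed

theorem theorem3p6:
  fixes sig :: "nat list" and K :: "struct set"
  assumes "is_class sig K"
  shows "(comp_reducible sig K LO_sig FLO \<longleftrightarrow>
           (\<exists>S. ce_struct_pairs sig LO_sig S \<and>
              (\<forall>A B. (A, B) \<in> S \<longrightarrow> is_struct sig A \<and> finite (fst A) \<and> B \<in> FLO) \<and>
              (\<forall>C \<in> K. \<exists>A B. (A, B) \<in> S \<and> substructure A C \<and> sufficient S C (A, B)) \<and>
              (\<forall>C C' A B A' B'. C \<in> K \<longrightarrow> C' \<in> K \<longrightarrow> (A, B) \<in> S \<longrightarrow> (A', B') \<in> S \<longrightarrow>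
                 substructure A C \<longrightarrow> substructure A' C' \<longrightarrow>
                 sufficient S C (A, B) \<longrightarrow> sufficient S C' (A', B') \<longrightarrow>
                 (iso C C' \<longleftrightarrow> iso B B'))))
       \<and> (comp_reducible sig K LO_sig FLO \<longleftrightarrow>
           (\<exists>\<phi>. computable_sigma1_seq sig \<phi> \<and>
              (\<forall>A \<in> K. \<exists>n. sat_sigma1 A (\<phi> n) \<and> \<not> sat_sigma1 A (\<phi> (Suc n))) \<and>
              (\<forall>A \<in> K. \<forall>n. sat_sigma1 A (\<phi> (Suc n)) \<longrightarrow> sat_sigma1 A (\<phi> n)) \<and>
              (\<forall>A \<in> K. \<forall>A' \<in> K. \<not> iso A A' \<longrightarrow>
                 (\<exists>n. sat_sigma1 A (\<phi> n) \<noteq> sat_sigma1 A' (\<phi> n)))))"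
proof (intro conjI iffI)
  assume "comp_reducible sig K LO_sig FLO"
  then obtain \<Phi> where emb: "computable_embedding sig K LO_sig FLO \<Phi>"
    unfolding comp_reducible_def by blast
  show "\<exists>S. ce_struct_pairs sig LO_sig S \<and>
      (\<forall>A B. (A, B) \<in> S \<longrightarrow> is_struct sig A \<and> finite (fst A) \<and> B \<in> FLO) \<and>
      (\<forall>C \<in> K. \<exists>A B. (A, B) \<in> S \<and> substructure A C \<and> sufficient S C (A, B)) \<and>
      (\<forall>C C' A B A' B'. C \<in> K \<longrightarrow> C' \<in> K \<longrightarrow> (A, B) \<in> S \<longrightarrow> (A', B') \<in> S \<longrightarrow>
         substructure A C \<longrightarrow> substructure A' C' \<longrightarrow>
         sufficient S C (A, B) \<longrightarrow> sufficient S C' (A', B') \<longrightarrow>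
         (iso C C' \<longleftrightarrow> iso B B'))"
    by (rule embedding_imp_pairs[OF assms emb])
  show "\<exists>\<phi>. computable_sigma1_seq sig \<phi> \<and>
      (\<forall>A \<in> K. \<exists>n. sat_sigma1 A (\<phi> n) \<and> \<not> sat_sigma1 A (\<phi> (Suc n))) \<and>
      (\<forall>A \<in> K. \<forall>n. sat_sigma1 A (\<phi> (Suc n)) \<longrightarrow> sat_sigma1 A (\<phi> n)) \<and>
      (\<forall>A \<in> K. \<forall>A' \<in> K. \<not> iso A A' \<longrightarrow> (\<exists>n. sat_sigma1 A (\<phi> n) \<noteq> sat_sigma1 A' (\<phi> n)))"
    by (rule embedding_imp_sentences[OF assms emb])
next
  assume "\<exists>S. ce_struct_pairs sig LO_sig S \<and>
      (\<forall>A B. (A, B) \<in> S \<longrightarrow> is_struct sig A \<and> finite (fst A) \<and> B \<in> FLO) \<and>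
      (\<forall>C \<in> K. \<exists>A B. (A, B) \<in> S \<and> substructure A C \<and> sufficient S C (A, B)) \<and>
      (\<forall>C C' A B A' B'. C \<in> K \<longrightarrow> C' \<in> K \<longrightarrow> (A, B) \<in> S \<longrightarrow> (A', B') \<in> S \<longrightarrow>
         substructure A C \<longrightarrow> substructure A' C' \<longrightarrow>
         sufficient S C (A, B) \<longrightarrow> sufficient S C' (A', B') \<longrightarrow>
         (iso C C' \<longleftrightarrow> iso B B'))" (is "\<exists>S. ?P S")
  then obtain S where S: "?P S" ..
  show "comp_reducible sig K LO_sig FLO"
  proof (rule pairs_imp_embedding[OF assms conjunct1[OF S]], goal_cases)
    case 1
    then show ?case by (rule S[THEN conjunct2, THEN conjunct1, rule_format])
  next
    case 2
    then show ?case by (rule S[THEN conjunct2, THEN conjunct2, THEN conjunct1, rule_format])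
  next
    case 3
    then show ?case by (rule S[THEN conjunct2, THEN conjunct2, THEN conjunct2, rule_format])
  qed
next
  assume "\<exists>\<phi>. computable_sigma1_seq sig \<phi> \<and>
      (\<forall>A \<in> K. \<exists>n. sat_sigma1 A (\<phi> n) \<and> \<not> sat_sigma1 A (\<phi> (Suc n))) \<and>
      (\<forall>A \<in> K. \<forall>n. sat_sigma1 A (\<phi> (Suc n)) \<longrightarrow> sat_sigma1 A (\<phi> n)) \<and>
      (\<forall>A \<in> K. \<forall>A' \<in> K. \<not> iso A A' \<longrightarrow> (\<exists>n. sat_sigma1 A (\<phi> n) \<noteq> sat_sigma1 A' (\<phi> n)))" (is "\<exists>\<phi>. ?P \<phi>")
  then obtain \<phi> where \<phi>: "?P \<phi>" ..
  show "comp_reducible sig K LO_sig FLO"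
  proof (rule sentences_imp_embedding[OF assms conjunct1[OF \<phi>]], goal_cases)
    case 1
    then show ?case by (rule \<phi>[THEN conjunct2, THEN conjunct1, rule_format])
  next
    case 2
    then show ?case by (rule \<phi>[THEN conjunct2, THEN conjunct2, THEN conjunct1, rule_format])
  next
    case 3
    then show ?case by (rule \<phi>[THEN conjunct2, THEN conjunct2, THEN conjunct2, rule_format])
  qed
qed

end
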